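(* Let $\mathcal{U}=\begin{bmatrix}\mathcal{A}&\mathcal{M}\\ \mathcal{N}&\mathcal{B}\end{bmatrix}$ be a unital 2-torsion free generalized matrix algebra satisfying $$a\in\mathcal{A},\ a\mathcal{M}=0\ \text{ and }\ \mathcal{N}a=0\ \Rightarrow\ a=0,$$ $$b\in\mathcal{B},\ \mathcal{M}b=0\ \text{ and }\ b\mathcal{N}=0\ \Rightarrow\ b=0.$$ Suppose that one of the following statements holds: (i) $[[\mathcal{A},\mathcal{A}],\mathcal{A}]=\mathcal{A}$ and $[[\mathcal{B},\mathcal{B}],\mathcal{B}]=\mathcal{B}$; (ii) $\pi_{\mathcal{A}}(Z(\mathcal{U}))=Z(\mathcal{A})$ and $[[\mathcal{A},\mathcal{A}],\mathcal{A}]=\mathcal{A}$; (iii) $\pi_{\mathcal{B}}(Z(\mathcal{U}))=Z(\mathcal{B})$ and $[[\mathcal{B},\mathcal{B}],\mathcal{B}]=\mathcal{B}$; (iv) $\pi_{\mathcal{A}}(Z(\mathcal{U}))=Z(\mathcal{A})$ and $\pi_{\mathcal{B}}(Z(\mathcal{U}))=Z(\mathcal{B})$, and at least one $\mathcal{G}\in\{\mathcal{A},\mathcal{B}\}$ satisfies: for all $x\in\mathcal{G}$, $[x,\mathcal{G}]\subseteq Z(\mathcal{G})$ implies $x\in Z(\mathcal{G})$. Assume also that one of the following statements holds: (a) $\mathcal{A}$ contains no nonzero central ideals; (b) $\mathcal{B}$ contains no nonzero central ideals; (c) $Z(\mathcal{U})=\left\{\begin{bmatrix}a&0\\0&b\end{bmatrix}: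 a\in Z(\mathcal{A}),\ b\in Z(\mathcal{B}),\ am_0=m_0b\right\}$ for some $m_0\in\mathcal{M}$; (d) $Z(\mathcal{U})=\left\{\begin{bmatrix}a&0\\0&b\end{bmatrix}: a\in Z(\mathcal{A}),\ b\in Z(\mathcal{B}),\ n_0a=bn_0\right\}$ for some $n_0\in\mathcal{N}$. Let $\Lambda:\mathcal{U}\to\mathcal{U}$ be a generalized Lie triple derivation associated with a Lie triple derivation $\xi:\mathcal{U}\to\mathcal{U}$. Then $$\Lambda(A)=\delta(A)+d(A)+\psi(A)+\lambda A\qquad\text{for all }A\in\mathcal{U},$$ where $\delta$ is a derivation on $\mathcal{U}$, $d$ is a singular Jordan derivation on $\mathcal{U}$, $\lambda\in Z(\mathcal{U})$, and $\psi:\mathcal{U}\to Z(\mathcal{U})$ is a linear map that vanishes on $[[\mathcal{U},\mathcal{U}],\mathcal{U}]$.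
   Context: All algebras (associative) and modules are over a unital commutative ring $\mathcal{R}$, and linear means $\mathcal{R}$-linear. $[x,y]=xy-yx$, $x\circ y=xy+yx$, and $Z(\mathcal{G})$ is the center of an algebra $\mathcal{G}$. $[[\mathcal{G},\mathcal{G}],\mathcal{G}]$ is the $\mathcal{R}$-submodule spanned by all $[[x,y],z]$ with $x,y,z\in\mathcal{G}$, and $[x,\mathcal{G}]=\{[x,y]:y\in\mathcal{G}\}$. A central ideal of $\mathcal{G}$ is an ideal contained in $Z(\mathcal{G})$. 2-torsion free means $2x=0$ implies $x=0$. A Morita context consists of algebras $\mathcal{A},\mathcal{B}$, an $(\mathcal{A},\mathcal{B})$-bimodule $\mathcal{M}$, a $(\mathcal{B},\mathcal{A})$-bimodule $\mathcal{N}$, and bimodule homomorphisms $\mathcal{M}\otimes_{\mathcal{B}}\mathcal{N}\to\mathcal{A}$, $m\otimes n\mapsto mn$, and $\mathcal{N}\otimes_{\mathcal{A}}\mathcal{M}\to\mathcal{B}$, $n\otimes m\mapsto nm$, satisfying $(mn)m'=m(nm')$ and $(nm)n'=n(mn')$ for all $m,m'\in\mathcal{M}$, $n,n'\in\mathcal{N}$. The set $\mathcal{U}=\begin{bmatrix}\mathcal{A}&\mathcal{M}\\ \mathcal{N}&\mathcal{B}\end{bmatrix}$ of all matrices $\begin{bmatrix}a&m\\ n&b\end{bmatrix}$ ($a\in\mathcal{A}$, $m\in\mathcal{M}$, $n\in\mathcal{N}$, $b\in\mathcal{B}$), with the usual matrix operations, is an algebra called a generalized matrix algebra. It is unital exactly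 when $\mathcal{A},\mathcal{B}$ are unital with identities $1_{\mathcal{A}},1_{\mathcal{B}}$ and $\mathcal{M},\mathcal{N}$ are unital bimodules ($1_{\mathcal{A}}m=m=m1_{\mathcal{B}}$, $1_{\mathcal{B}}n=n=n1_{\mathcal{A}}$). The projections $\pi_{\mathcal{A}}:\mathcal{U}\to\mathcal{A}$ and $\pi_{\mathcal{B}}:\mathcal{U}\to\mathcal{B}$ send $\begin{bmatrix}a&m\\ n&b\end{bmatrix}$ to $a$ and $b$, respectively. Definitions for linear maps on $\mathcal{U}$ (identities for all $A,B,C\in\mathcal{U}$): - $\delta$ is a derivation if $\delta(AB)=\delta(A)B+A\delta(B)$. - $\xi$ is a Lie triple derivation if $\xi([[A,B],C])=[[\xi(A),B],C]+[[A,\xi(B)],C]+[[A,B],\xi(C)]$. - $\Lambda$ is a generalized Lie triple derivation associated with the Lie triple derivation $\xi$ if $\Lambda([[A,B],C])=[[\Lambda(A),B],C]+[[A,\xi(B)],C]+[[A,B],\xi(C)]$. - $d$ is a Jordan derivation if $d(A\circ B)=A\circ d(B)+d(A)\circ B$. A Jordan derivation $d$ is singular if there are linear maps $\tau:\mathcal{M}\to\mathcal{N}$ and $\varrho:\mathcal{N}\to\mathcal{M}$ with $d\left(\begin{bmatrix}0&m\\ n&0\end{bmatrix}\right)=\begin{bmatrix}0&\varrho(n)\\ \tau(m)&0\end{bmatrix}$ for all $m\in\mathcal{M}$, $n\in\mathcal{N}$. *)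

theory Defs
  imports Complex_Main
begin

definition module_bilinear ::
  "('r::comm_ring_1 \<Rightarrow> 'u::ab_group_add \<Rightarrow> 'u) \<Rightarrow> ('r \<Rightarrow> 'v::ab_group_add \<Rightarrow> 'v) \<Rightarrow>
   ('r \<Rightarrow> 'w::ab_group_add \<Rightarrow> 'w) \<Rightarrow> ('u \<Rightarrow> 'v \<Rightarrow> 'w) \<Rightarrow> bool" where
  "module_bilinear s1 s2 s3 f \<longleftrightarrow>
     (\<forall>x. module_hom s2 s3 (f x)) \<and> (\<forall>y. module_hom s1 s3 (\<lambda>x. f x y))"

text \<open>
  The product is a parameter rather than the class operation \<open>(*)\<close>, because the product of a
  generalized matrix algebra depends on the Morita context. No identity element is required.
\<close>

locale assoc_algebra = module scale
  for scale :: "'r::comm_ring_1 \<Rightarrow> 'u::ab_group_add \<Rightarrow> 'u" +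
  fixes mult :: "'u \<Rightarrow> 'u \<Rightarrow> 'u"
  assumes mult_bilinear: "module_bilinear scale scale scale mult"
    and mult_assoc: "mult (mult x y) z = mult x (mult y z)"

definition is_unital :: "('u \<Rightarrow> 'u \<Rightarrow> 'u) \<Rightarrow> bool" where
  "is_unital mult \<longleftrightarrow> (\<exists>e. \<forall>x. mult e x = x \<and> mult x e = x)"

definition lie_bracket :: "('u \<Rightarrow> 'u \<Rightarrow> 'u) \<Rightarrow> 'u \<Rightarrow> 'u \<Rightarrow> 'u::ab_group_add" where
  "lie_bracket mult x y = mult x y - mult y x"

definition jordan_product :: "('u \<Rightarrow> 'u \<Rightarrow> 'u) \<Rightarrow> 'u \<Rightarrow> 'u \<Rightarrow> 'u::ab_group_add" where
  "jordan_product mult x y = mult x y + mult y x"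

definition algebra_center :: "('u \<Rightarrow> 'u \<Rightarrow> 'u) \<Rightarrow> 'u set" where
  "algebra_center mult = {z. \<forall>x. mult z x = mult x z}"

definition triple_commutator_space ::
  "('r::comm_ring_1 \<Rightarrow> 'u::ab_group_add \<Rightarrow> 'u) \<Rightarrow> ('u \<Rightarrow> 'u \<Rightarrow> 'u) \<Rightarrow> 'u set" where
  "triple_commutator_space scale mult =
     module.span scale {lie_bracket mult (lie_bracket mult x y) z | x y z. True}"

definition algebra_ideal ::
  "('r::comm_ring_1 \<Rightarrow> 'u::ab_group_add \<Rightarrow> 'u) \<Rightarrow> ('u \<Rightarrow> 'u \<Rightarrow> 'u) \<Rightarrow> 'u set \<Rightarrow> bool" where
  "algebra_ideal scale mult I \<longleftrightarrow>
     module.subspace scale I \<and> (\<forall>x. \<forall>y\<in>I. mult x y \<in> I \<and> mult y x \<in> I)"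

definition central_ideal ::
  "('r::comm_ring_1 \<Rightarrow> 'u::ab_group_add \<Rightarrow> 'u) \<Rightarrow> ('u \<Rightarrow> 'u \<Rightarrow> 'u) \<Rightarrow> 'u set \<Rightarrow> bool" where
  "central_ideal scale mult I \<longleftrightarrow> algebra_ideal scale mult I \<and> I \<subseteq> algebra_center mult"

definition derivation ::
  "('r::comm_ring_1 \<Rightarrow> 'u::ab_group_add \<Rightarrow> 'u) \<Rightarrow> ('u \<Rightarrow> 'u \<Rightarrow> 'u) \<Rightarrow> ('u \<Rightarrow> 'u) \<Rightarrow> bool" where
  "derivation scale mult \<delta> \<longleftrightarrow> module_hom scale scale \<delta> \<and>
     (\<forall>x y. \<delta> (mult x y) = mult (\<delta> x) y + mult x (\<delta> y))"

definition lie_triple_derivation ::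
  "('r::comm_ring_1 \<Rightarrow> 'u::ab_group_add \<Rightarrow> 'u) \<Rightarrow> ('u \<Rightarrow> 'u \<Rightarrow> 'u) \<Rightarrow> ('u \<Rightarrow> 'u) \<Rightarrow> bool" where
  "lie_triple_derivation scale mult \<xi> \<longleftrightarrow> module_hom scale scale \<xi> \<and>
     (\<forall>x y z. \<xi> (lie_bracket mult (lie_bracket mult x y) z) =
        lie_bracket mult (lie_bracket mult (\<xi> x) y) z +
        lie_bracket mult (lie_bracket mult x (\<xi> y)) z +
        lie_bracket mult (lie_bracket mult x y) (\<xi> z))"

definition generalized_lie_triple_derivation ::
  "('r::comm_ring_1 \<Rightarrow> 'u::ab_group_add \<Rightarrow> 'u) \<Rightarrow> ('u \<Rightarrow> 'u \<Rightarrow> 'u) \<Rightarrow>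
   ('u \<Rightarrow> 'u) \<Rightarrow> ('u \<Rightarrow> 'u) \<Rightarrow> bool" where
  "generalized_lie_triple_derivation scale mult \<xi> \<Lambda> \<longleftrightarrow>
     lie_triple_derivation scale mult \<xi> \<and> module_hom scale scale \<Lambda> \<and>
     (\<forall>x y z. \<Lambda> (lie_bracket mult (lie_bracket mult x y) z) =
        lie_bracket mult (lie_bracket mult (\<Lambda> x) y) z +
        lie_bracket mult (lie_bracket mult x (\<xi> y)) z +
        lie_bracket mult (lie_bracket mult x y) (\<xi> z))"

definition jordan_derivation ::
  "('r::comm_ring_1 \<Rightarrow> 'u::ab_group_add \<Rightarrow> 'u) \<Rightarrow> ('u \<Rightarrow> 'u \<Rightarrow> 'u) \<Rightarrow> ('u \<Rightarrow> 'u) \<Rightarrow> bool" where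
  "jordan_derivation scale mult d \<longleftrightarrow> module_hom scale scale d \<and>
     (\<forall>x y. d (jordan_product mult x y) =
        jordan_product mult x (d y) + jordan_product mult (d x) y)"

locale algebra_bimodule =
  left: assoc_algebra sA "(*)" + right: assoc_algebra sB "(*)" + module sM
  for sA :: "'r::comm_ring_1 \<Rightarrow> 'a::ring \<Rightarrow> 'a"
    and sB :: "'r \<Rightarrow> 'b::ring \<Rightarrow> 'b"
    and sM :: "'r \<Rightarrow> 'm::ab_group_add \<Rightarrow> 'm" +
  fixes lact :: "'a \<Rightarrow> 'm \<Rightarrow> 'm"
    and ract :: "'m \<Rightarrow> 'b \<Rightarrow> 'm"
  assumes lact_bilinear: "module_bilinear sA sM sM lact"
    and ract_bilinear: "module_bilinear sM sB sM ract"
    and lact_assoc: "lact (a * a') m = lact a (lact a' m)"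
    and ract_assoc: "ract m (b * b') = ract (ract m b) b'"
    and lact_ract: "ract (lact a m) b = lact a (ract m b)"

text \<open>
  A bimodule homomorphism out of the tensor product of \<open>M\<close> and \<open>N\<close> over \<open>B\<close> is given, via the
  universal property of the tensor product, as an \<open>R\<close>-bilinear map on pairs that is \<open>B\<close>-balanced
  and linear over the outer algebra on both sides.
\<close>

locale balanced_pairing =
  left: algebra_bimodule sA sB sM lactM ractM + right: algebra_bimodule sB sA sN lactN ractN
  for sA :: "'r::comm_ring_1 \<Rightarrow> 'a::ring \<Rightarrow> 'a"
    and sB :: "'r \<Rightarrow> 'b::ring \<Rightarrow> 'b"
    and sM :: "'r \<Rightarrow> 'm::ab_group_add \<Rightarrow> 'm"
    and sN :: "'r \<Rightarrow> 'n::ab_group_add \<Rightarrow> 'n"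
    and lactM :: "'a \<Rightarrow> 'm \<Rightarrow> 'm" and ractM :: "'m \<Rightarrow> 'b \<Rightarrow> 'm"
    and lactN :: "'b \<Rightarrow> 'n \<Rightarrow> 'n" and ractN :: "'n \<Rightarrow> 'a \<Rightarrow> 'n" +
  fixes pair :: "'m \<Rightarrow> 'n \<Rightarrow> 'a"
  assumes pair_bilinear: "module_bilinear sM sN sA pair"
    and pair_balanced: "pair (ractM m b) n = pair m (lactN b n)"
    and pair_left: "pair (lactM a m) n = a * pair m n"
    and pair_right: "pair m (ractN n a) = pair m n * a"

text \<open>
  \<open>A\<close> and \<open>B\<close> are in class \<open>ring\<close>, which requires neither an identity element nor nontriviality.
\<close>

record ('r, 'a, 'b, 'm, 'n) morita_data =
  scaleA :: "'r \<Rightarrow> 'a \<Rightarrow> 'a"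
  scaleB :: "'r \<Rightarrow> 'b \<Rightarrow> 'b"
  scaleM :: "'r \<Rightarrow> 'm \<Rightarrow> 'm"
  scaleN :: "'r \<Rightarrow> 'n \<Rightarrow> 'n"
  actAM :: "'a \<Rightarrow> 'm \<Rightarrow> 'm"
  actMB :: "'m \<Rightarrow> 'b \<Rightarrow> 'm"
  actBN :: "'b \<Rightarrow> 'n \<Rightarrow> 'n"
  actNA :: "'n \<Rightarrow> 'a \<Rightarrow> 'n"
  pairMN :: "'m \<Rightarrow> 'n \<Rightarrow> 'a"
  pairNM :: "'n \<Rightarrow> 'm \<Rightarrow> 'b"

locale morita_context =
  MN: balanced_pairing "scaleA K" "scaleB K" "scaleM K" "scaleN K"
    "actAM K" "actMB K" "actBN K" "actNA K" "pairMN K" +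
  NM: balanced_pairing "scaleB K" "scaleA K" "scaleN K" "scaleM K"
    "actBN K" "actNA K" "actAM K" "actMB K" "pairNM K"
  for K :: "('r::comm_ring_1, 'a::ring, 'b::ring, 'm::ab_group_add, 'n::ab_group_add) morita_data" +
  assumes MN_assoc: "actAM K (pairMN K m n) m' = actMB K m (pairNM K n m')"
    and NM_assoc: "actBN K (pairNM K n m) n' = actNA K n (pairMN K m n')"

text \<open>\<open>Mat a m n b\<close> is the matrix with first row \<open>a, m\<close> and second row \<open>n, b\<close>.\<close>

datatype ('a, 'm, 'n, 'b) gmat = Mat (matA: 'a) (matM: 'm) (matN: 'n) (matB: 'b)

instantiation gmat :: (ab_group_add, ab_group_add, ab_group_add, ab_group_add) ab_group_add
begin

definition "0 = Mat 0 0 0 0"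

definition "X + Y = Mat (matA X + matA Y) (matM X + matM Y) (matN X + matN Y) (matB X + matB Y)"

definition "X - Y = Mat (matA X - matA Y) (matM X - matM Y) (matN X - matN Y) (matB X - matB Y)"

definition "- X = Mat (- matA X) (- matM X) (- matN X) (- matB X)"

instance
  by standard
    (simp_all add: zero_gmat_def plus_gmat_def minus_gmat_def uminus_gmat_def add_ac)

end

fun gm_scale ::
  "('r, 'a, 'b, 'm, 'n) morita_data \<Rightarrow> 'r \<Rightarrow> ('a, 'm, 'n, 'b) gmat \<Rightarrow> ('a, 'm, 'n, 'b) gmat" where
  "gm_scale K r (Mat a m n b) =
     Mat (scaleA K r a) (scaleM K r m) (scaleN K r n) (scaleB K r b)"

fun gm_mult ::
  "('r, 'a::ring, 'b::ring, 'm::ab_group_add, 'n::ab_group_add) morita_data \<Rightarrow>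
   ('a, 'm, 'n, 'b) gmat \<Rightarrow> ('a, 'm, 'n, 'b) gmat \<Rightarrow> ('a, 'm, 'n, 'b) gmat" where
  "gm_mult K (Mat a m n b) (Mat a' m' n' b') =
     Mat (a * a' + pairMN K m n') (actAM K a m' + actMB K m b')
         (actNA K n a' + actBN K b n') (pairNM K n m' + b * b')"

definition singular_jordan_derivation ::
  "('r::comm_ring_1, 'a::ring, 'b::ring, 'm::ab_group_add, 'n::ab_group_add) morita_data \<Rightarrow>
   (('a, 'm, 'n, 'b) gmat \<Rightarrow> ('a, 'm, 'n, 'b) gmat) \<Rightarrow> bool" where
  "singular_jordan_derivation K d \<longleftrightarrow> jordan_derivation (gm_scale K) (gm_mult K) d \<and>
     (\<exists>\<tau> \<rho>. module_hom (scaleM K) (scaleN K) \<tau> \<and> module_hom (scaleN K) (scaleM K) \<rho> \<and>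
        (\<forall>m n. d (Mat 0 m n 0) = Mat 0 (\<rho> n) (\<tau> m) 0))"

lemma (in morita_context) gm_assoc_algebra: "assoc_algebra (gm_scale K) (gm_mult K)"
proof -
  note bil = MN.left.left.mult_bilinear MN.left.right.mult_bilinear
    MN.left.lact_bilinear MN.left.ract_bilinear MN.right.lact_bilinear MN.right.ract_bilinear
    MN.pair_bilinear NM.pair_bilinear
  note hom = bil[unfolded module_bilinear_def module_hom_def module_hom_axioms_def]
  have add: "gm_mult K (X + X') Y = gm_mult K X Y + gm_mult K X' Y"
    "gm_mult K Y (X + X') = gm_mult K Y X + gm_mult K Y X'" for X X' Y
    using hom by (cases X; cases X'; cases Y; simp add: plus_gmat_def algebra_simps)+
  have sc: "gm_mult K (gm_scale K r X) Y = gm_scale K r (gm_mult K X Y)"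
    "gm_mult K Y (gm_scale K r X) = gm_scale K r (gm_mult K Y X)" for r X Y
    using hom by (cases X; cases Y; simp add: module.scale_right_distrib)+
  interpret module "gm_scale K"
  proof
    fix r s :: 'r and X Y :: "('a, 'm, 'n, 'b) gmat"
    show "gm_scale K r (X + Y) = gm_scale K r X + gm_scale K r Y"
      using hom by (cases X; cases Y; simp add: plus_gmat_def module.scale_right_distrib)
    show "gm_scale K (r + s) X = gm_scale K r X + gm_scale K s X"
      using hom by (cases X; simp add: plus_gmat_def module.scale_left_distrib)
    show "gm_scale K r (gm_scale K s X) = gm_scale K (r * s) X"
      using hom by (cases X; simp add: module.scale_scale)
    show "gm_scale K 1 X = X"
      using hom by (cases X; simp add: module.scale_one)
  qed
  show ?thesis
  proof
    show "module_bilinear (gm_scale K) (gm_scale K) (gm_scale K) (gm_mult K)"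
      unfolding module_bilinear_def module_hom_def module_hom_axioms_def
      using add sc module_axioms by simp
    show "gm_mult K (gm_mult K X Y) Z = gm_mult K X (gm_mult K Y Z)" for X Y Z
      using hom
      by (cases X; cases Y; cases Z;
          simp add: algebra_simps MN.left.lact_assoc MN.left.ract_assoc MN.left.lact_ract
            MN.right.lact_assoc MN.right.ract_assoc MN.right.lact_ract
            MN.pair_left MN.pair_right MN.pair_balanced
            NM.pair_left NM.pair_right NM.pair_balanced MN_assoc NM_assoc)
  qed
qed

lemma (in morita_context) gm_unital_iff:
  "is_unital (gm_mult K) \<longleftrightarrow>
     (\<exists>e f. (\<forall>a. e * a = a \<and> a * e = a) \<and> (\<forall>b. f * b = b \<and> b * f = b) \<and>
        (\<forall>m. actAM K e m = m \<and> actMB K m f = m) \<and>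
        (\<forall>n. actBN K f n = n \<and> actNA K n e = n))" (is "?L \<longleftrightarrow> ?R")
proof -
  note bil = MN.left.left.mult_bilinear MN.left.right.mult_bilinear
    MN.left.lact_bilinear MN.left.ract_bilinear MN.right.lact_bilinear MN.right.ract_bilinear
    MN.pair_bilinear NM.pair_bilinear
  have zero: "g 0 y = 0" "g x 0 = 0" if "module_bilinear s1 s2 s3 g" for s1 s2 s3 g x y
    using that module_hom.zero unfolding module_bilinear_def by fastforce+
  note z = bil[THEN zero(1)] bil[THEN zero(2)]
  show ?thesis
  proof
    assume ?L
    then obtain e m0 n0 f where E: "\<And>X. gm_mult K (Mat e m0 n0 f) X = X"
        "\<And>X. gm_mult K X (Mat e m0 n0 f) = X"
      unfolding is_unital_def by (metis gmat.exhaust)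
    have "e * a = a \<and> a * e = a" for a
      using E[of "Mat a 0 0 0"] by (simp add: z)
    moreover have "f * b = b \<and> b * f = b" for b
      using E[of "Mat 0 0 0 b"] by (simp add: z)
    moreover have "actAM K e m = m \<and> actMB K m f = m" for m
      using E[of "Mat 0 m 0 0"] by (simp add: z)
    moreover have "actBN K f n = n \<and> actNA K n e = n" for n
      using E[of "Mat 0 0 n 0"] by (simp add: z)
    ultimately show ?R by blast
  next
    assume ?R
    then obtain e f where ef: "\<And>a. e * a = a \<and> a * e = a" "\<And>b. f * b = b \<and> b * f = b"
        "\<And>m. actAM K e m = m \<and> actMB K m f = m" "\<And>n. actBN K f n = n \<and> actNA K n e = n"
      by blast
    have "gm_mult K (Mat e 0 0 f) X = X \<and> gm_mult K X (Mat e 0 0 f) = X" for X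
      by (cases X) (simp add: ef z)
    then show ?L unfolding is_unital_def by blast
  qed
qed

end

theory Submission
  imports Defs
begin

text \<open>
  Let \<open>e\<close> and \<open>f\<close> be the diagonal idempotents of the matrix algebra \<open>U\<close>, so that \<open>e + f = 1\<close> and
  \<open>A\<close>, \<open>M\<close>, \<open>N\<close>, \<open>B\<close> become the Peirce corners \<open>e U e\<close>, \<open>e U f\<close>, \<open>f U e\<close>, \<open>f U f\<close>. The argument only
  uses these idempotents, and it is symmetric under exchanging \<open>e\<close> and \<open>f\<close>; so it is carried out in
  an algebra with two complementary idempotents (\<open>peirce_algebra\<close>), where half of the statements
  follow from the other half by exchanging the idempotents. By faithfulness, a diagonal element
  that commutes with \<open>M\<close> and \<open>N\<close> is central (\<open>center_criterion\<close>), and a central element inside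
  \<open>A\<close> or inside \<open>B\<close> is zero.

  Put \<open>\<Delta> = \<Lambda> - \<xi>\<close>. Then \<open>\<Delta> [[x, y], z] = [[\<Delta> x, y], z]\<close>. Taking \<open>z = e\<close> shows that \<open>\<Delta>\<close> maps diagonal
  elements to diagonal elements and that \<open>\<Delta> m = [\<Delta> e, m]\<close> for \<open>m\<close> in \<open>M\<close>, and similarly on \<open>N\<close>. The
  diagonal entries of \<open>\<Delta> e\<close> are central in their corners, and each alternative in
  \<open>center_condition\<close> lets one replace them by a single central \<open>l\<close> with \<open>\<Delta> m = l m\<close> and \<open>\<Delta> n = l n\<close>. Then \<open>\<Delta> u - l u\<close> is
  central for every \<open>u\<close> (\<open>triple_centralizer_standard_form\<close>).

  It remains to decompose \<open>\<xi>\<close>. After subtracting an inner derivation, \<open>\<xi> e\<close> is diagonal; then it is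
  even central, because \<open>m = [[m, e], e]\<close> forces \<open>2 [m, \<xi> e] = 0\<close>. Consequently \<open>\<xi>\<close> preserves the
  diagonal and maps \<open>M + N\<close> to itself. The part that exchanges \<open>M\<close> and \<open>N\<close> is a singular Jordan
  derivation (\<open>singular_part_jordan\<close>), the decisive relation coming from \<open>[[e, m], m'] = 0\<close>. Jordan
  derivations are Lie triple derivations, so this part can be subtracted as well, and \<open>\<xi>\<close> now
  preserves \<open>M\<close>, \<open>N\<close> and the diagonal. By \<open>center_condition\<close> the \<open>B\<close>-entry of \<open>\<xi> x\<close>, for \<open>x\<close> in \<open>A\<close>, is the
  \<open>B\<close>-entry of a central element, and symmetrically (\<open>image_splits\<close>). Subtracting
  these central values leaves a map \<open>\<delta>\<close> that preserves all four corners.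

  The failure of \<open>\<delta>\<close> to be a derivation is the Hochschild cocycle
  \<open>\<delta> (u v) - \<delta> u v - u \<delta> v\<close>. Faithfulness kills it except on \<open>M \<times> N\<close> and \<open>N \<times> M\<close>. There it takes
  values in \<open>Z(A)\<close> and \<open>Z(B)\<close>, spans central ideals, and is skew in the sense of
  \<open>defect_skew\<close>; each alternative in \<open>central_ideal_condition\<close> then forces it
  to vanish (\<open>defect_off_zero\<close>). Finally,
  a Lie triple derivation with central values, or a central-valued map with the property of \<open>\<Delta>\<close>,
  vanishes on triple commutators.
\<close>

section \<open>Derivations and corners of an associative algebra\<close>

context assoc_algebra
begin

notation mult (infixl "\<cdot>" 70)

abbreviation bracket :: "'u \<Rightarrow> 'u \<Rightarrow> 'u" ("\<langle>_, _\<rangle>")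
  where "\<langle>x, y\<rangle> \<equiv> lie_bracket mult x y"

lemma mult_linear:
  "(x + y) \<cdot> z = x \<cdot> z + y \<cdot> z" "x \<cdot> (y + z) = x \<cdot> y + x \<cdot> z"
  "(x - y) \<cdot> z = x \<cdot> z - y \<cdot> z" "x \<cdot> (y - z) = x \<cdot> y - x \<cdot> z"
  "(- x) \<cdot> z = - (x \<cdot> z)" "x \<cdot> (- z) = - (x \<cdot> z)"
  "0 \<cdot> z = 0" "x \<cdot> 0 = 0"
  "scale r x \<cdot> z = scale r (x \<cdot> z)" "x \<cdot> scale r z = scale r (x \<cdot> z)"
proof -
  interpret l: module_hom scale scale "\<lambda>x. x \<cdot> z"
    using mult_bilinear by (auto simp: module_bilinear_def)
  interpret r: module_hom scale scale "\<lambda>z. x \<cdot> z"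
    using mult_bilinear by (auto simp: module_bilinear_def)
  show "(x + y) \<cdot> z = x \<cdot> z + y \<cdot> z" "x \<cdot> (y + z) = x \<cdot> y + x \<cdot> z"
    "(x - y) \<cdot> z = x \<cdot> z - y \<cdot> z" "x \<cdot> (y - z) = x \<cdot> y - x \<cdot> z"
    "(- x) \<cdot> z = - (x \<cdot> z)" "x \<cdot> (- z) = - (x \<cdot> z)"
    "0 \<cdot> z = 0" "x \<cdot> 0 = 0"
    "scale r x \<cdot> z = scale r (x \<cdot> z)" "x \<cdot> scale r z = scale r (x \<cdot> z)"
    by (simp_all add: l.add l.diff l.neg l.scale r.add r.diff r.neg r.scale)
qed

lemmas mult_simps = mult_linear mult_assoc algebra_simps

lemma homI:
  assumes "\<And>x y. g (x + y) = g x + g y" "\<And>r x. g (scale r x) = scale r (g x)"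
  shows "module_hom scale scale g"
  using assms module_axioms by (simp add: module_hom_iff)

lemma bracket_linear:
  "\<langle>x + y, z\<rangle> = \<langle>x, z\<rangle> + \<langle>y, z\<rangle>" "\<langle>x, y + z\<rangle> = \<langle>x, y\<rangle> + \<langle>x, z\<rangle>"
  "\<langle>x - y, z\<rangle> = \<langle>x, z\<rangle> - \<langle>y, z\<rangle>" "\<langle>x, y - z\<rangle> = \<langle>x, y\<rangle> - \<langle>x, z\<rangle>"
  "\<langle>- x, z\<rangle> = - \<langle>x, z\<rangle>" "\<langle>x, - z\<rangle> = - \<langle>x, z\<rangle>"
  "\<langle>0, z\<rangle> = 0" "\<langle>x, 0\<rangle> = 0"
  by (simp_all add: lie_bracket_def mult_simps)

lemma bracket_swap: "\<langle>y, x\<rangle> = - \<langle>x, y\<rangle>"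
  by (simp add: lie_bracket_def)

abbreviation center :: "'u set" where "center \<equiv> algebra_center mult"

lemma center_iff_bracket: "z \<in> center \<longleftrightarrow> (\<forall>x. \<langle>z, x\<rangle> = 0)"
  by (simp add: algebra_center_def lie_bracket_def)

lemma centerD: "z \<in> center \<Longrightarrow> z \<cdot> x = x \<cdot> z"
  by (simp add: algebra_center_def)

lemma bracket_center: "z \<in> center \<Longrightarrow> \<langle>z, x\<rangle> = 0" "z \<in> center \<Longrightarrow> \<langle>x, z\<rangle> = 0"
  by (simp_all add: algebra_center_def lie_bracket_def)

lemma subspace_center: "subspace center"
  by (rule subspaceI) (auto simp: algebra_center_def mult_linear)

definition corner :: "'u \<Rightarrow> 'u \<Rightarrow> 'u set"
  where "corner p q = {x. p \<cdot> x = x \<and> x \<cdot> q = x}"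

definition commutant :: "'u \<Rightarrow> 'u set"
  where "commutant p = {x. p \<cdot> x = x \<cdot> p}"

definition corner_center :: "'u \<Rightarrow> 'u set"
  where "corner_center p = {x \<in> corner p p. \<forall>y \<in> corner p p. x \<cdot> y = y \<cdot> x}"

text \<open>
  For orthogonal idempotents \<open>p\<close> and \<open>q\<close> with sum \<open>1\<close>, the following predicates express what the two
  groups of alternative hypotheses say about the corners. They take the idempotents as arguments,
  so that they can be used with the two idempotents exchanged.
\<close>

definition center_lifts :: "'u \<Rightarrow> bool"
  where "center_lifts p \<longleftrightarrow> (\<forall>x \<in> corner_center p. \<exists>z \<in> center. p \<cdot> z = x)"

definition corner_triple_perfect :: "'u \<Rightarrow> bool"
  where "corner_triple_perfect p \<longleftrightarrow>
    corner p p \<subseteq> span {\<langle>\<langle>x, y\<rangle>, z\<rangle> | x y z.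
      x \<in> corner p p \<and> y \<in> corner p p \<and> z \<in> corner p p}"

definition corner_bracket_central :: "'u \<Rightarrow> bool"
  where "corner_bracket_central p \<longleftrightarrow> (\<forall>x \<in> corner p p.
    (\<forall>y \<in> corner p p. \<langle>x, y\<rangle> \<in> corner_center p) \<longrightarrow> x \<in> corner_center p)"

definition center_condition :: "'u \<Rightarrow> 'u \<Rightarrow> bool"
  where "center_condition p q \<longleftrightarrow>
    (corner_triple_perfect p \<and> corner_triple_perfect q) \<or>
    (center_lifts p \<and> corner_triple_perfect p) \<or>
    (center_lifts q \<and> corner_triple_perfect q) \<or>
    (center_lifts p \<and> center_lifts q \<and>
      (corner_bracket_central p \<or> corner_bracket_central q))"

text \<open>
  Stated for principal ideals: a nonzero central ideal contains some \<open>c \<noteq> 0\<close> all of whose multiples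
  are central, and the multiples of such a \<open>c\<close> form a nonzero central ideal.
\<close>

definition no_central_ideal :: "'u \<Rightarrow> bool"
  where "no_central_ideal p \<longleftrightarrow>
    (\<forall>c \<in> corner p p. (\<forall>x \<in> corner p p. x \<cdot> c \<in> corner_center p) \<longrightarrow> c = 0)"

definition witness_detects_center :: "'u \<Rightarrow> 'u \<Rightarrow> bool"
  where "witness_detects_center p q \<longleftrightarrow> (\<exists>w \<in> corner p q.
    \<forall>a \<in> corner_center p. \<forall>b \<in> corner_center q. a \<cdot> w = w \<cdot> b \<longrightarrow> a + b \<in> center)"

definition central_ideal_condition :: "'u \<Rightarrow> 'u \<Rightarrow> bool"
  where "central_ideal_condition p q \<longleftrightarrow> no_central_ideal p \<or> no_central_ideal q \<or>
    witness_detects_center p q \<or> witness_detects_center q p"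

lemma cornerI: "p \<cdot> x = x \<Longrightarrow> x \<cdot> q = x \<Longrightarrow> x \<in> corner p q"
  by (simp add: corner_def)

lemma subspace_corner: "subspace (corner p q)"
  by (rule subspaceI) (auto simp: corner_def mult_linear)

lemma corner_mult_mem: "x \<in> corner p q \<Longrightarrow> y \<in> corner r s \<Longrightarrow> x \<cdot> y \<in> corner p s"
  by (auto simp: corner_def mult_assoc) (simp flip: mult_assoc)

lemma corner_closed:
  "x \<in> corner p q \<Longrightarrow> y \<in> corner p q \<Longrightarrow> x + y \<in> corner p q"
  "x \<in> corner p q \<Longrightarrow> y \<in> corner p q \<Longrightarrow> x - y \<in> corner p q"
  "x \<in> corner p q \<Longrightarrow> - x \<in> corner p q" "0 \<in> corner p q"
  by (simp_all add: corner_def mult_linear)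

lemma derivation_inner: "derivation scale mult (\<lambda>x. \<langle>t, x\<rangle>)"
  unfolding derivation_def by (auto intro!: homI simp: lie_bracket_def mult_simps)

lemma derivation_sum:
  assumes "derivation scale mult g" "derivation scale mult h"
  shows "derivation scale mult (\<lambda>x. g x + h x)"
  using assms unfolding derivation_def
  by (auto simp: module_hom_iff mult_simps)

lemma lie_triple_derivation_inner: "lie_triple_derivation scale mult (\<lambda>x. \<langle>t, x\<rangle>)"
  unfolding lie_triple_derivation_def by (auto intro!: homI simp: lie_bracket_def mult_simps)

lemma lie_triple_derivation_diff:
  assumes "lie_triple_derivation scale mult g" "lie_triple_derivation scale mult h"
  shows "lie_triple_derivation scale mult (\<lambda>x. g x - h x)"
  using assms unfolding lie_triple_derivation_def
  by (auto simp: module_hom_iff bracket_linear algebra_simps)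

lemma lie_triple_derivation_of_derivation:
  assumes "derivation scale mult g"
  shows "lie_triple_derivation scale mult g"
proof -
  interpret g: module_hom scale scale g using assms by (simp add: derivation_def)
  have g: "g (x \<cdot> y) = g x \<cdot> y + x \<cdot> g y" for x y using assms by (simp add: derivation_def)
  show ?thesis
    unfolding lie_triple_derivation_def lie_bracket_def
    by (intro conjI allI g.module_hom_axioms) (simp add: g.add g.diff g mult_simps)
qed

text \<open>
  The double commutator is a Jordan polynomial:
  \<open>[[x, y], z] = x \<circ> (y \<circ> z) - y \<circ> (x \<circ> z)\<close>.
\<close>

lemma lie_triple_derivation_of_jordan:
  assumes "jordan_derivation scale mult g"
  shows "lie_triple_derivation scale mult g"
proof -
  interpret g: module_hom scale scale g using assms by (simp add: jordan_derivation_def)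
  have triple: "\<langle>\<langle>x, y\<rangle>, z\<rangle> = jordan_product mult x (jordan_product mult y z)
      - jordan_product mult y (jordan_product mult x z)" for x y z
    by (simp add: lie_bracket_def jordan_product_def mult_simps)
  have g: "g (jordan_product mult x y)
      = jordan_product mult x (g y) + jordan_product mult (g x) y" for x y
    using assms by (simp add: jordan_derivation_def)
  have add: "jordan_product mult x (y + z) = jordan_product mult x y + jordan_product mult x z"
    for x y z by (simp add: jordan_product_def mult_simps)
  show ?thesis
    unfolding lie_triple_derivation_def
    by (intro conjI allI g.module_hom_axioms) (simp add: triple g.diff g add)
qed

lemma hom_zero_on_span:
  assumes g: "module_hom scale scale g" and S: "\<And>y. y \<in> S \<Longrightarrow> g y = 0" and x: "x \<in> span S"
  shows "g x = 0"
proof -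
  have zero: "module_hom scale scale (\<lambda>_. 0)" by (rule homI) auto
  have "module_pair scale scale" by (simp add: module_pair_def module_axioms)
  from module_pair.module_hom_eq_on_span[OF this g zero S x] show ?thesis .
qed

text \<open>
  All three terms of the defining identity contain a commutator with a central element.
\<close>

lemma central_lie_triple_derivation_vanishes:
  assumes "lie_triple_derivation scale mult \<psi>" "range \<psi> \<subseteq> center"
    and "x \<in> triple_commutator_space scale mult"
  shows "\<psi> x = 0"
proof -
  have c: "\<psi> u \<in> center" for u using assms(2) by blast
  show ?thesis
  proof (rule hom_zero_on_span[where g = \<psi> and S = "{\<langle>\<langle>x, y\<rangle>, z\<rangle> | x y z. True}"])
    show "module_hom scale scale \<psi>" using assms(1) by (simp add: lie_triple_derivation_def)
    show "x \<in> span {\<langle>\<langle>x, y\<rangle>, z\<rangle> | x y z. True}"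
      using assms(3) by (simp add: triple_commutator_space_def)
    show "\<psi> y = 0" if "y \<in> {\<langle>\<langle>x, y\<rangle>, z\<rangle> | x y z. True}" for y
      using that assms(1)
      by (auto simp: lie_triple_derivation_def bracket_center[OF c] bracket_linear)
  qed
qed

lemma corner_triple_perfect_vanish:
  assumes "corner_triple_perfect p" "module_hom scale scale g" "x \<in> corner p p"
    and zero: "\<And>x y z. x \<in> corner p p \<Longrightarrow> y \<in> corner p p \<Longrightarrow> z \<in> corner p p \<Longrightarrow>
      g \<langle>\<langle>x, y\<rangle>, z\<rangle> = 0"
  shows "g x = 0"
proof -
  let ?S = "{\<langle>\<langle>x, y\<rangle>, z\<rangle> | x y z. x \<in> corner p p \<and> y \<in> corner p p \<and> z \<in> corner p p}"
  have "g y = 0" if "y \<in> ?S" for y using that zero by auto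
  moreover have "x \<in> span ?S" using assms(1,3) unfolding corner_triple_perfect_def by blast
  ultimately show ?thesis by (rule hom_zero_on_span[OF assms(2)])
qed

text \<open>
  A submodule \<open>Z\<close> that meets \<open>W\<close> trivially contains at most one correction of \<open>g u\<close> into \<open>W\<close>; hence the
  choice of corrections is automatically linear.
\<close>

lemma linear_choice:
  assumes g: "module_hom scale scale g" and Z: "subspace Z" and W: "subspace W"
    and ZW: "Z \<inter> W = {0}" and ex: "\<And>u. \<exists>z \<in> Z. g u - z \<in> W"
  obtains \<psi> where "module_hom scale scale \<psi>" "\<And>u. \<psi> u \<in> Z" "\<And>u. g u - \<psi> u \<in> W"
    "\<And>u. g u = 0 \<Longrightarrow> \<psi> u = 0"
proof -
  interpret g: module_hom scale scale g by (rule g)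
  define \<psi> where "\<psi> u = (SOME z. z \<in> Z \<and> g u - z \<in> W)" for u
  have \<psi>: "\<psi> u \<in> Z \<and> g u - \<psi> u \<in> W" for u
    unfolding \<psi>_def by (rule someI_ex) (use ex[of u] in blast)
  have unique: "\<psi> u = z" if "z \<in> Z" "g u - z \<in> W" for u z
  proof -
    have "\<psi> u - z \<in> Z" using \<psi> that Z by (simp add: subspace_diff)
    moreover have "(g u - z) - (g u - \<psi> u) \<in> W"
      using \<psi> that W by (blast intro: subspace_diff)
    then have "\<psi> u - z \<in> W" by simp
    ultimately have "\<psi> u - z = 0" using ZW by blast
    then show ?thesis by simp
  qed
  show ?thesis
  proof (rule that)
    show "module_hom scale scale \<psi>"
    proof (rule homI)
      fix u v r
      have "(g u - \<psi> u) + (g v - \<psi> v) \<in> W" using \<psi> W by (blast intro: subspace_add)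
      then have "g (u + v) - (\<psi> u + \<psi> v) \<in> W" by (simp add: g.add algebra_simps)
      then show "\<psi> (u + v) = \<psi> u + \<psi> v"
        using \<psi> Z by (intro unique) (blast intro: subspace_add)+
      have "scale r (g u - \<psi> u) \<in> W" using \<psi> W by (blast intro: subspace_scale)
      then have "g (scale r u) - scale r (\<psi> u) \<in> W"
        by (simp add: g.scale scale_right_diff_distrib)
      then show "\<psi> (scale r u) = scale r (\<psi> u)"
        using \<psi> Z by (intro unique) (blast intro: subspace_scale)+
    qed
    show "\<psi> u = 0" if "g u = 0" for u
      using that Z W by (intro unique) (auto simp: subspace_0)
  qed (use \<psi> in auto)
qed

end

section \<open>Peirce decompositions\<close>

text \<open>
  The intrinsic form of a faithful generalized matrix algebra: the entries are recovered as the four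
  corners, and the module actions and pairings as restrictions of a single product.
\<close>

locale peirce_algebra = assoc_algebra scale mult
  for scale :: "'r::comm_ring_1 \<Rightarrow> 'u::ab_group_add \<Rightarrow> 'u"
    and mult :: "'u \<Rightarrow> 'u \<Rightarrow> 'u" +
  fixes e f :: 'u
  assumes ee: "mult e e = e" and ff: "mult f f = f"
    and ef: "mult e f = 0" and fe: "mult f e = 0"
    and unit: "mult (e + f) x = x" "mult x (e + f) = x"
    and two_torsion_free: "x + x = 0 \<Longrightarrow> x = 0"
    and faithful_e: "x \<in> corner e e \<Longrightarrow> (\<And>m. m \<in> corner e f \<Longrightarrow> mult x m = 0) \<Longrightarrow>
      (\<And>n. n \<in> corner f e \<Longrightarrow> mult n x = 0) \<Longrightarrow> x = 0"
    and faithful_f: "x \<in> corner f f \<Longrightarrow> (\<And>m. m \<in> corner e f \<Longrightarrow> mult m x = 0) \<Longrightarrow>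
      (\<And>n. n \<in> corner f e \<Longrightarrow> mult x n = 0) \<Longrightarrow> x = 0"
begin

lemma swap: "peirce_algebra scale mult f e"
  by unfold_locales
    (auto simp: ee ff ef fe add.commute[of f e] unit intro: two_torsion_free faithful_e faithful_f)

lemma idempotents:
  "e \<cdot> e = e" "f \<cdot> f = f" "e \<cdot> f = 0" "f \<cdot> e = 0"
  "e \<cdot> (e \<cdot> u) = e \<cdot> u" "f \<cdot> (f \<cdot> u) = f \<cdot> u" "e \<cdot> (f \<cdot> u) = 0" "f \<cdot> (e \<cdot> u) = 0"
  using ee ff ef fe by (simp_all flip: mult_assoc add: mult_linear)

lemma e_f_mem: "e \<in> corner e e" "f \<in> corner f f"
  by (simp_all add: corner_def idempotents)

lemma f_mult: "f \<cdot> x = x - e \<cdot> x" "x \<cdot> f = x - x \<cdot> e"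
  using unit[of x] by (simp_all add: mult_linear algebra_simps)

lemma corner_absorb:
  "x \<in> corner p q \<Longrightarrow> p \<cdot> x = x" "x \<in> corner p q \<Longrightarrow> x \<cdot> q = x"
  "x \<in> corner p q \<Longrightarrow> p \<cdot> (x \<cdot> u) = x \<cdot> u" "x \<in> corner p q \<Longrightarrow> x \<cdot> (q \<cdot> u) = x \<cdot> u"
  by (auto simp: corner_def simp flip: mult_assoc)

lemma corner_kill:
  assumes "x \<in> corner p q"
  shows "q = e \<Longrightarrow> x \<cdot> f = 0" "q = f \<Longrightarrow> x \<cdot> e = 0"
    "p = e \<Longrightarrow> f \<cdot> x = 0" "p = f \<Longrightarrow> e \<cdot> x = 0"
proof -
  have x: "x = p \<cdot> (x \<cdot> q)" using assms by (simp add: corner_absorb)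
  show "q = e \<Longrightarrow> x \<cdot> f = 0" "q = f \<Longrightarrow> x \<cdot> e = 0"
    "p = e \<Longrightarrow> f \<cdot> x = 0" "p = f \<Longrightarrow> e \<cdot> x = 0"
    by (subst x, simp add: mult_assoc idempotents mult_linear)+
qed

text \<open>
  The middle idempotents collide in \<open>x y = x (q r) y\<close>. Like the neighbouring rules, this is also given
  with a further factor \<open>u\<close>, to rewrite inside products that are nested to the right.
\<close>

lemma corner_zero:
  assumes "x \<in> corner p q" "y \<in> corner r s" "q \<cdot> r = 0"
  shows "x \<cdot> y = 0" "x \<cdot> (y \<cdot> u) = 0"
proof -
  have "x \<cdot> y = (x \<cdot> q) \<cdot> (r \<cdot> y)" using assms by (simp add: corner_absorb)
  also have "\<dots> = x \<cdot> ((q \<cdot> r) \<cdot> y)" by (simp only: mult_assoc)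
  finally show "x \<cdot> y = 0" using assms by (simp add: mult_linear)
  then show "x \<cdot> (y \<cdot> u) = 0" by (simp flip: mult_assoc add: mult_linear)
qed

lemma corner_kill_mult:
  assumes "x \<in> corner p q"
  shows "q = e \<Longrightarrow> x \<cdot> (f \<cdot> u) = 0" "q = f \<Longrightarrow> x \<cdot> (e \<cdot> u) = 0"
    "p = e \<Longrightarrow> f \<cdot> (x \<cdot> u) = 0" "p = f \<Longrightarrow> e \<cdot> (x \<cdot> u) = 0"
  using corner_kill[OF assms] by (simp_all flip: mult_assoc add: mult_linear)

lemma peirce_zero:
  "x \<in> corner p e \<Longrightarrow> y \<in> corner f s \<Longrightarrow> x \<cdot> y = 0"
  "x \<in> corner p f \<Longrightarrow> y \<in> corner e s \<Longrightarrow> x \<cdot> y = 0"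
  "x \<in> corner p e \<Longrightarrow> y \<in> corner f s \<Longrightarrow> x \<cdot> (y \<cdot> u) = 0"
  "x \<in> corner p f \<Longrightarrow> y \<in> corner e s \<Longrightarrow> x \<cdot> (y \<cdot> u) = 0"
  by (simp_all add: corner_zero[where q = e and r = f] corner_zero[where q = f and r = e] ef fe)

lemmas peirce_simps = idempotents corner_absorb corner_kill[OF _ refl] corner_kill_mult[OF _ refl]
  peirce_zero

lemma component_mem: "e \<cdot> u \<cdot> e \<in> corner e e" "e \<cdot> u \<cdot> f \<in> corner e f"
  "f \<cdot> u \<cdot> e \<in> corner f e" "f \<cdot> u \<cdot> f \<in> corner f f"
  by (simp_all add: corner_def mult_assoc idempotents)

lemma peirce_decomposition: "u = e \<cdot> u \<cdot> e + e \<cdot> u \<cdot> f + f \<cdot> u \<cdot> e + f \<cdot> u \<cdot> f"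
  by (simp add: f_mult mult_simps)

text \<open>
  Additive statements need to be checked on the four corners only; nested twice, this reduces
  biadditive identities to sixteen cases, most of them trivial by orthogonality.
\<close>

lemma peirce_induct [case_names add ee ef fe ff]:
  assumes "\<And>u v. P u \<Longrightarrow> P v \<Longrightarrow> P (u + v)"
    and "\<And>u. u \<in> corner e e \<Longrightarrow> P u" "\<And>u. u \<in> corner e f \<Longrightarrow> P u"
    and "\<And>u. u \<in> corner f e \<Longrightarrow> P u" "\<And>u. u \<in> corner f f \<Longrightarrow> P u"
  shows "P u"
  by (subst peirce_decomposition[of u])
    (rule assms(1) assms(2)[OF component_mem(1)] assms(3)[OF component_mem(2)]
      assms(4)[OF component_mem(3)] assms(5)[OF component_mem(4)])+

text \<open>
  The commutant of \<open>e\<close> is the diagonal subalgebra \<open>e U e + f U f\<close>. The following lemmas say that the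
  diagonal acts on each corner.
\<close>

lemma commutant_f: "commutant f = commutant e"
  by (auto simp: commutant_def f_mult)

lemma commutant_mem: "x \<in> corner e e \<Longrightarrow> x \<in> commutant e" "x \<in> corner f f \<Longrightarrow> x \<in> commutant e"
  by (simp_all add: commutant_def peirce_simps)

lemma center_commutant: "z \<in> center \<Longrightarrow> z \<in> commutant p"
  by (simp add: algebra_center_def commutant_def)

lemma commutantD:
  assumes "x \<in> commutant e"
  shows "x \<cdot> e = e \<cdot> x" "x \<cdot> f = f \<cdot> x" "x \<cdot> (e \<cdot> u) = e \<cdot> (x \<cdot> u)" "x \<cdot> (f \<cdot> u) = f \<cdot> (x \<cdot> u)"
proof -
  show "x \<cdot> e = e \<cdot> x" "x \<cdot> f = f \<cdot> x" using assms by (simp_all add: commutant_def f_mult)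
  then show "x \<cdot> (e \<cdot> u) = e \<cdot> (x \<cdot> u)" "x \<cdot> (f \<cdot> u) = f \<cdot> (x \<cdot> u)" by (simp_all flip: mult_assoc)
qed

lemma commutant_split:
  assumes "x \<in> commutant e"
  shows "e \<cdot> x \<in> corner e e" "f \<cdot> x \<in> corner f f" "x = e \<cdot> x + f \<cdot> x"
  using assms by (simp_all add: corner_def mult_linear mult_assoc idempotents commutantD f_mult)

lemma commutant_mult_mem:
  assumes "x \<in> commutant e"
  shows "m \<in> corner e q \<Longrightarrow> x \<cdot> m \<in> corner e q" "m \<in> corner f q \<Longrightarrow> x \<cdot> m \<in> corner f q"
    "m \<in> corner p e \<Longrightarrow> m \<cdot> x \<in> corner p e" "m \<in> corner p f \<Longrightarrow> m \<cdot> x \<in> corner p f"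
proof -
  show "x \<cdot> m \<in> corner e q" if "m \<in> corner e q"
    using that by (simp add: corner_def mult_assoc flip: commutantD(3)[OF assms])
  show "x \<cdot> m \<in> corner f q" if "m \<in> corner f q"
    using that by (simp add: corner_def mult_assoc flip: commutantD(4)[OF assms])
  show "m \<cdot> x \<in> corner p e" if "m \<in> corner p e"
    using that by (simp add: corner_def mult_assoc commutantD[OF assms])
      (simp flip: mult_assoc)
  show "m \<cdot> x \<in> corner p f" if "m \<in> corner p f"
    using that by (simp add: corner_def mult_assoc commutantD[OF assms])
      (simp flip: mult_assoc)
qed

lemma bracket_commutant_mem:
  assumes "x \<in> commutant e"
  shows "m \<in> corner e f \<Longrightarrow> \<langle>x, m\<rangle> \<in> corner e f" "m \<in> corner f e \<Longrightarrow> \<langle>x, m\<rangle> \<in> corner f e"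
    "m \<in> corner e f \<Longrightarrow> \<langle>m, x\<rangle> \<in> corner e f" "m \<in> corner f e \<Longrightarrow> \<langle>m, x\<rangle> \<in> corner f e"
    "m \<in> corner e e \<Longrightarrow> \<langle>x, m\<rangle> \<in> corner e e" "m \<in> corner f f \<Longrightarrow> \<langle>x, m\<rangle> \<in> corner f f"
  unfolding lie_bracket_def by (simp_all add: corner_closed commutant_mult_mem[OF assms])

lemma bracket_idempotent:
  "m \<in> corner e f \<Longrightarrow> \<langle>m, e\<rangle> = - m" "m \<in> corner e f \<Longrightarrow> \<langle>e, m\<rangle> = m"
  "n \<in> corner f e \<Longrightarrow> \<langle>n, e\<rangle> = n" "n \<in> corner f e \<Longrightarrow> \<langle>e, n\<rangle> = - n"
  "x \<in> commutant e \<Longrightarrow> \<langle>x, e\<rangle> = 0" "x \<in> commutant e \<Longrightarrow> \<langle>e, x\<rangle> = 0"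
  by (simp_all add: lie_bracket_def peirce_simps commutant_def)

lemma bracket_e_part:
  assumes "x \<in> corner e e" "y \<in> commutant e"
  shows "\<langle>e \<cdot> y, x\<rangle> = - \<langle>x, y\<rangle>"
  using assms commutantD(3)[OF assms(2), of x]
  by (simp add: lie_bracket_def mult_assoc peirce_simps)

lemma bracket_off_diagonal:
  "m \<in> corner e f \<Longrightarrow> m' \<in> corner e f \<Longrightarrow> \<langle>m, m'\<rangle> = 0"
  "m \<in> corner f e \<Longrightarrow> m' \<in> corner f e \<Longrightarrow> \<langle>m, m'\<rangle> = 0"
  by (simp_all add: lie_bracket_def peirce_zero)

text \<open>
  Double commutation with \<open>e\<close> is the projection onto the off-diagonal part. This is what makes triple
  identities with last entry \<open>e\<close> informative.
\<close>

lemma double_bracket_e: "\<langle>\<langle>u, e\<rangle>, e\<rangle> = e \<cdot> u \<cdot> f + f \<cdot> u \<cdot> e"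
  by (simp add: lie_bracket_def f_mult mult_simps idempotents)

lemma commutant_of_double_bracket:
  assumes "\<langle>\<langle>u, e\<rangle>, e\<rangle> = 0"
  shows "u \<in> commutant e"
proof -
  have off: "e \<cdot> u \<cdot> f + f \<cdot> u \<cdot> e = 0" using assms by (simp add: double_bracket_e)
  from arg_cong[OF off, of "\<lambda>v. e \<cdot> v"] arg_cong[OF off, of "\<lambda>v. f \<cdot> v"]
  have "e \<cdot> (u \<cdot> f) = 0" "f \<cdot> (u \<cdot> e) = 0"
    by (simp_all add: mult_linear mult_assoc idempotents)
  then show ?thesis
    by (simp add: commutant_def f_mult mult_linear)
qed

text \<open>
  If \<open>z\<close> commutes with \<open>m\<close> and with \<open>x m\<close>, then \<open>[z, x] m = 0\<close>; likewise \<open>n [z, x] = 0\<close>. So \<open>[z, x]\<close>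
  vanishes by faithfulness.
\<close>

lemma center_commutes_ee:
  assumes z: "z \<in> commutant e"
    and zm: "\<And>m. m \<in> corner e f \<Longrightarrow> \<langle>z, m\<rangle> = 0" and zn: "\<And>n. n \<in> corner f e \<Longrightarrow> \<langle>z, n\<rangle> = 0"
    and x: "x \<in> corner e e"
  shows "\<langle>z, x\<rangle> = 0"
proof (rule faithful_e)
  show "\<langle>z, x\<rangle> \<in> corner e e" using z x by (rule bracket_commutant_mem)
  show "\<langle>z, x\<rangle> \<cdot> m = 0" if m: "m \<in> corner e f" for m
  proof -
    have "\<langle>z, x\<rangle> \<cdot> m = \<langle>z, x \<cdot> m\<rangle> - x \<cdot> \<langle>z, m\<rangle>"
      by (simp add: lie_bracket_def mult_simps)
    then show ?thesis
      using zm[OF m] zm[OF corner_mult_mem[OF x m]] by (simp add: mult_linear)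
  qed
  show "n \<cdot> \<langle>z, x\<rangle> = 0" if n: "n \<in> corner f e" for n
  proof -
    have "n \<cdot> \<langle>z, x\<rangle> = \<langle>z, n \<cdot> x\<rangle> - \<langle>z, n\<rangle> \<cdot> x"
      by (simp add: lie_bracket_def mult_simps)
    then show ?thesis
      using zn[OF n] zn[OF corner_mult_mem[OF n x]] by (simp add: mult_linear)
  qed
qed

lemma center_criterion:
  assumes z: "z \<in> commutant e"
    and zm: "\<And>m. m \<in> corner e f \<Longrightarrow> \<langle>z, m\<rangle> = 0" and zn: "\<And>n. n \<in> corner f e \<Longrightarrow> \<langle>z, n\<rangle> = 0"
  shows "z \<in> center"
proof -
  interpret sw: peirce_algebra scale mult f e by (rule swap)
  have "\<langle>z, u\<rangle> = 0" for u
  proof (induction u rule: peirce_induct)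
    case (ff u)
    then show ?case using sw.center_commutes_ee[of z u] z zm zn by (simp add: commutant_f)
  qed (simp_all add: bracket_linear zm zn center_commutes_ee[OF assms])
  then show ?thesis by (simp add: center_iff_bracket)
qed

text \<open>
  Here \<open>z m = m z = 0\<close> because \<open>z\<close> has no component in \<open>f U f\<close>, so faithfulness applies.
\<close>

lemma center_corner_zero:
  assumes "z \<in> center" "z \<in> corner e e"
  shows "z = 0"
proof (rule faithful_e)
  show "z \<in> corner e e" by fact
  show "z \<cdot> m = 0" if "m \<in> corner e f" for m
    using that assms(2) centerD[OF assms(1), of m] by (simp add: peirce_zero)
  show "n \<cdot> z = 0" if "n \<in> corner f e" for n
    using that assms(2) centerD[OF assms(1), of n] by (simp add: peirce_zero)
qed

lemma center_corner_zero': "z \<in> center \<Longrightarrow> z \<in> corner f f \<Longrightarrow> z = 0"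
  by (rule peirce_algebra.center_corner_zero[OF swap])

lemma center_part_mem: "z \<in> center \<Longrightarrow> e \<cdot> z \<in> corner_center e" "z \<in> center \<Longrightarrow> f \<cdot> z \<in> corner_center f"
  by (auto simp: corner_center_def mult_assoc centerD peirce_simps intro!: cornerI)

lemma corner_center_diff:
  "x \<in> corner_center p \<Longrightarrow> y \<in> corner_center p \<Longrightarrow> x - y \<in> corner_center p"
  by (simp add: corner_center_def corner_closed mult_linear)

end

section \<open>Triple centralizers\<close>

text \<open>
  This is the property of the difference between a generalized Lie triple derivation and its
  associated Lie triple derivation.
\<close>

locale peirce_triple_centralizer = peirce_algebra scale mult e f
  for scale :: "'r::comm_ring_1 \<Rightarrow> 'u::ab_group_add \<Rightarrow> 'u"
    and mult :: "'u \<Rightarrow> 'u \<Rightarrow> 'u" and e f :: 'u +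
  fixes \<Delta> :: "'u \<Rightarrow> 'u"
  assumes hom: "module_hom scale scale \<Delta>"
    and triple1: "\<Delta> (lie_bracket mult (lie_bracket mult x y) z) =
      lie_bracket mult (lie_bracket mult (\<Delta> x) y) z"
begin

sublocale \<Delta>: module_hom scale scale \<Delta> by (rule hom)

lemma swap_centralizer: "peirce_triple_centralizer scale mult f e \<Delta>"
  by (intro peirce_triple_centralizer.intro swap peirce_triple_centralizer_axioms.intro hom triple1)

lemma diagonal: "x \<in> commutant e \<Longrightarrow> \<Delta> x \<in> commutant e"
  by (rule commutant_of_double_bracket)
    (simp flip: triple1 add: bracket_idempotent bracket_linear \<Delta>.zero)

text \<open>
  Since \<open>[x, m]\<close> and \<open>[\<Delta> x, m]\<close> lie in \<open>e U f\<close>, the outer commutator with \<open>e\<close> only changes their sign.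
\<close>

lemma bracket_ef:
  assumes x: "x \<in> commutant e" and m: "m \<in> corner e f"
  shows "\<Delta> \<langle>x, m\<rangle> = \<langle>\<Delta> x, m\<rangle>"
proof -
  have "\<Delta> \<langle>\<langle>x, m\<rangle>, e\<rangle> = \<langle>\<langle>\<Delta> x, m\<rangle>, e\<rangle>" by (rule triple1)
  then show ?thesis
    using bracket_commutant_mem(1)[OF x m] bracket_commutant_mem(1)[OF diagonal[OF x] m]
    by (simp add: bracket_idempotent \<Delta>.neg)
qed

lemma bracket_fe: "x \<in> commutant e \<Longrightarrow> n \<in> corner f e \<Longrightarrow> \<Delta> \<langle>x, n\<rangle> = \<langle>\<Delta> x, n\<rangle>"
  using peirce_triple_centralizer.bracket_ef[OF swap_centralizer] by (simp add: commutant_f)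

lemma e_mem: "e \<in> commutant e" "f \<in> commutant e"
  by (simp_all add: commutant_def idempotents)

text \<open>
  The element \<open>[\<Delta> e, x]\<close> is central, since \<open>[[\<Delta> e, x], z] = \<Delta> [[e, x], z] = 0\<close>; but it also lies in a
  diagonal corner, which contains no nonzero central element.
\<close>

lemma commutes_with_diagonal:
  shows "x \<in> corner e e \<Longrightarrow> \<langle>\<Delta> e, x\<rangle> = 0" "x \<in> corner f f \<Longrightarrow> \<langle>\<Delta> e, x\<rangle> = 0"
proof -
  have c: "\<langle>\<Delta> e, x\<rangle> \<in> center" if "x \<in> commutant e" for x
    unfolding center_iff_bracket
    using that by (simp flip: triple1 add: bracket_idempotent bracket_linear \<Delta>.zero)
  have d: "\<Delta> e \<in> commutant e" by (intro diagonal e_mem)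
  show "x \<in> corner e e \<Longrightarrow> \<langle>\<Delta> e, x\<rangle> = 0" "x \<in> corner f f \<Longrightarrow> \<langle>\<Delta> e, x\<rangle> = 0"
    using c commutant_mem bracket_commutant_mem[OF d] center_corner_zero center_corner_zero'
    by blast+
qed

lemma parts_central: "e \<cdot> \<Delta> e \<in> corner_center e" "f \<cdot> \<Delta> e \<in> corner_center f"
proof -
  have d: "\<Delta> e \<in> commutant e" by (intro diagonal e_mem)
  show "e \<cdot> \<Delta> e \<in> corner_center e" 
    using commutes_with_diagonal(1) commutant_split(1)[OF d]
    by (auto simp: corner_center_def mult_assoc lie_bracket_def peirce_simps)
  show "f \<cdot> \<Delta> e \<in> corner_center f" 
    using commutes_with_diagonal(2) commutant_split(2)[OF d]
    by (auto simp: corner_center_def mult_assoc lie_bracket_def peirce_simps)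
qed

text \<open>
  The central element \<open>z\<close> transports the \<open>f\<close>-entry of \<open>\<Delta> e\<close> to the other corner:
  \<open>\<Delta> m = [\<Delta> e, m] = (e \<Delta> e) m - m (f \<Delta> e) = (e \<Delta> e - e z) m = l m\<close>.
  Once \<open>\<Delta>\<close> is multiplication by \<open>l\<close> on the off-diagonal corners, \<open>\<Delta> x - l x\<close> commutes with them for
  every diagonal \<open>x\<close>.
\<close>

lemma scalar_plus_central:
  assumes z: "z \<in> center" and l: "l \<in> center"
    and fz: "f \<cdot> z = f \<cdot> \<Delta> e" and el: "e \<cdot> l = e \<cdot> \<Delta> e - e \<cdot> z"
  shows "\<Delta> u - l \<cdot> u \<in> center"
proof -
  have d: "\<Delta> e \<in> commutant e" by (intro diagonal e_mem)
  have M: "\<Delta> m = l \<cdot> m" if m: "m \<in> corner e f" for m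
  proof -
    have "\<Delta> m = \<langle>\<Delta> e, m\<rangle>" using bracket_ef[OF e_mem(1) m] m by (simp add: bracket_idempotent)
    also have "\<dots> = (e \<cdot> \<Delta> e) \<cdot> m - m \<cdot> (f \<cdot> \<Delta> e)"
      using m commutantD(3)[OF d, of m] by (simp add: lie_bracket_def mult_assoc peirce_simps)
    also have "e \<cdot> \<Delta> e = e \<cdot> l + e \<cdot> z" using el by simp
    also have "(e \<cdot> l + e \<cdot> z) \<cdot> m - m \<cdot> (f \<cdot> \<Delta> e) = l \<cdot> m"
      using m by (simp flip: fz add: mult_linear mult_assoc centerD[OF z] centerD[OF l] peirce_simps)
    finally show ?thesis .
  qed
  have N: "\<Delta> n = l \<cdot> n" if n: "n \<in> corner f e" for n
  proof -
    have "- \<Delta> n = \<langle>\<Delta> e, n\<rangle>"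
      using bracket_fe[OF e_mem(1) n] n by (simp add: bracket_idempotent \<Delta>.neg)
    also have "\<dots> = (f \<cdot> \<Delta> e) \<cdot> n - n \<cdot> (e \<cdot> \<Delta> e)"
      using n commutantD(4)[OF d, of n] by (simp add: lie_bracket_def mult_assoc peirce_simps)
    also have "e \<cdot> \<Delta> e = e \<cdot> l + e \<cdot> z" using el by simp
    also have "(f \<cdot> \<Delta> e) \<cdot> n - n \<cdot> (e \<cdot> l + e \<cdot> z) = - (l \<cdot> n)"
      using n by (simp flip: fz add: mult_linear mult_assoc centerD[OF z] centerD[OF l] peirce_simps)
    finally show ?thesis by simp
  qed
  have D: "\<Delta> x - l \<cdot> x \<in> center" if x: "x \<in> commutant e" for x
  proof (rule center_criterion)
    have "l \<cdot> x \<in> commutant e"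
      using x centerD[OF l] by (simp add: commutant_def mult_assoc) (simp flip: mult_assoc)
    then show "\<Delta> x - l \<cdot> x \<in> commutant e"
      using diagonal[OF x] by (simp add: commutant_def mult_linear)
    have lx: "\<langle>l \<cdot> x, u\<rangle> = l \<cdot> \<langle>x, u\<rangle>" for u
      using centerD[OF l, of u] by (simp add: lie_bracket_def mult_simps flip: mult_assoc)
    show "\<langle>\<Delta> x - l \<cdot> x, m\<rangle> = 0" if m: "m \<in> corner e f" for m
      using bracket_ef[OF x m] M[OF bracket_commutant_mem(1)[OF x m]]
      by (simp add: bracket_linear lx)
    show "\<langle>\<Delta> x - l \<cdot> x, n\<rangle> = 0" if n: "n \<in> corner f e" for n
      using bracket_fe[OF x n] N[OF bracket_commutant_mem(2)[OF x n]]
      by (simp add: bracket_linear lx)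
  qed
  show ?thesis
  proof (induction u rule: peirce_induct)
    case (add u v)
    then show ?case
      using subspace_add[OF subspace_center add] by (simp add: \<Delta>.add mult_simps)
  qed (use D commutant_mem M N subspace_0[OF subspace_center] in auto)
qed

text \<open>
  On triple commutators of elements of \<open>e U e\<close> the value \<open>[[\<Delta> x, y], z]\<close> stays in \<open>e U e\<close>.
\<close>

lemma triple_perfect_e:
  assumes "corner_triple_perfect e"
  shows "f \<cdot> \<Delta> e = 0"
proof (rule corner_triple_perfect_vanish[OF assms, where g = "\<lambda>u. f \<cdot> \<Delta> u"])
  show "module_hom scale scale (\<lambda>u. f \<cdot> \<Delta> u)"
    by (rule homI) (simp_all add: \<Delta>.add \<Delta>.scale mult_linear)
  show "f \<cdot> \<Delta> \<langle>\<langle>x, y\<rangle>, z\<rangle> = 0"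
    if "x \<in> corner e e" "y \<in> corner e e" "z \<in> corner e e" for x y z
  proof -
    have "\<langle>\<langle>\<Delta> x, y\<rangle>, z\<rangle> \<in> corner e e"
      using that by (intro bracket_commutant_mem commutant_mem diagonal)
    then show ?thesis by (simp add: triple1 peirce_simps)
  qed
qed (rule e_f_mem)

lemma unit_image_central: "\<Delta> (e + f) \<in> center"
proof (rule center_criterion)
  have u: "e + f \<in> commutant e" by (simp add: commutant_def mult_linear idempotents)
  then show "\<Delta> (e + f) \<in> commutant e" by (rule diagonal)
  have "\<langle>e + f, x\<rangle> = 0" for x by (simp add: lie_bracket_def unit)
  then show "\<langle>\<Delta> (e + f), m\<rangle> = 0" if "m \<in> corner e f" for m
    using bracket_ef[OF u that] by (simp add: \<Delta>.zero)
  show "\<langle>\<Delta> (e + f), n\<rangle> = 0" if "n \<in> corner f e" for n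
    using bracket_fe[OF u that] \<open>\<And>x. \<langle>e + f, x\<rangle> = 0\<close> by (simp add: \<Delta>.zero)
qed

lemma scalar_plus_central_if_perfect_lifts:
  assumes "center_lifts e" "corner_triple_perfect e"
  shows "\<exists>l \<in> center. \<forall>u. \<Delta> u - l \<cdot> u \<in> center"
proof -
  obtain l where "l \<in> center" "e \<cdot> l = e \<cdot> \<Delta> e"
    using assms(1) parts_central(1) unfolding center_lifts_def by blast
  then show ?thesis
    using scalar_plus_central[of 0 l] triple_perfect_e[OF assms(2)] subspace_0[OF subspace_center]
    by (auto simp: mult_linear)
qed

text \<open>
  The task is to find the \<open>z\<close> and \<open>l\<close> of \<open>scalar_plus_central\<close>. When both corners are triple perfect,
  \<open>\<Delta> e\<close> and \<open>\<Delta> f\<close> stay in their corners, so that \<open>z = 0\<close> and \<open>l = \<Delta> 1\<close> work; in the remaining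
  cases the central elements of at least one corner lift to central elements of \<open>U\<close>.
\<close>

theorem triple_centralizer_standard_form:
  assumes "center_condition e f"
  shows "\<exists>l \<in> center. \<forall>u. \<Delta> u - l \<cdot> u \<in> center"
proof -
  interpret sw: peirce_triple_centralizer scale mult f e \<Delta> by (rule swap_centralizer)
  consider "corner_triple_perfect e" "corner_triple_perfect f"
    | "center_lifts e" "corner_triple_perfect e" | "center_lifts f" "corner_triple_perfect f"
    | "center_lifts e" "center_lifts f"
    using assms unfolding center_condition_def by blast
  then show ?thesis
  proof cases
    case 1
    then have "f \<cdot> \<Delta> e = 0" "e \<cdot> \<Delta> f = 0" by (simp_all add: triple_perfect_e sw.triple_perfect_e)
    then have "\<Delta> u - \<Delta> (e + f) \<cdot> u \<in> center" for u
      by (intro scalar_plus_central[of 0] unit_image_central subspace_0[OF subspace_center])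
        (simp_all add: mult_linear \<Delta>.add)
    then show ?thesis using unit_image_central by blast
  next
    case 2
    then show ?thesis by (rule scalar_plus_central_if_perfect_lifts)
  next
    case 3
    then show ?thesis by (rule sw.scalar_plus_central_if_perfect_lifts)
  next
    case 4
    obtain z where z: "z \<in> center" "f \<cdot> z = f \<cdot> \<Delta> e"
      using 4 parts_central(2) unfolding center_lifts_def by blast
    have "e \<cdot> \<Delta> e - e \<cdot> z \<in> corner_center e"
      using parts_central(1) center_part_mem(1)[OF z(1)] by (rule corner_center_diff)
    then obtain l where "l \<in> center" "e \<cdot> l = e \<cdot> \<Delta> e - e \<cdot> z"
      using 4 unfolding center_lifts_def by blast
    then show ?thesis using scalar_plus_central z by blast
  qed
qed

end

section \<open>The singular Jordan part of a Lie triple derivation\<close>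

context peirce_algebra
begin

text \<open>
  On the diagonal \<open>d\<close> vanishes, so the Jordan identity mixes only a diagonal with an off-diagonal
  element, where it is \<open>d_bracket\<close>, or two elements of the same off-diagonal corner, where it is
  \<open>skew\<close>: for \<open>m\<close> and \<open>m'\<close> in \<open>e U f\<close> one has \<open>m \<circ> m' = 0\<close>. In the other cases both sides vanish.
\<close>

lemma singular_jordan_derivationI:
  assumes hom: "module_hom scale scale d"
    and diag: "\<And>x. x \<in> corner e e \<Longrightarrow> d x = 0" "\<And>y. y \<in> corner f f \<Longrightarrow> d y = 0"
    and off: "\<And>m. m \<in> corner e f \<Longrightarrow> d m \<in> corner f e" "\<And>n. n \<in> corner f e \<Longrightarrow> d n \<in> corner e f"
    and d_bracket: "\<And>x m. x \<in> commutant e \<Longrightarrow> m \<in> corner e f \<Longrightarrow> d \<langle>x, m\<rangle> = - \<langle>x, d m\<rangle>"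
      "\<And>x n. x \<in> commutant e \<Longrightarrow> n \<in> corner f e \<Longrightarrow> d \<langle>x, n\<rangle> = - \<langle>x, d n\<rangle>"
    and skew: "\<And>m m'. m \<in> corner e f \<Longrightarrow> m' \<in> corner e f \<Longrightarrow> m \<cdot> d m' + d m \<cdot> m' + (m' \<cdot> d m + d m' \<cdot> m) = 0"
      "\<And>n n'. n \<in> corner f e \<Longrightarrow> n' \<in> corner f e \<Longrightarrow> n \<cdot> d n' + d n \<cdot> n' + (n' \<cdot> d n + d n' \<cdot> n) = 0"
  shows "jordan_derivation scale mult d"
proof -
  interpret d: module_hom scale scale d by (rule hom)
  have mult: "x \<in> corner e e \<Longrightarrow> m \<in> corner e f \<Longrightarrow> d (x \<cdot> m) = d m \<cdot> x"
    "y \<in> corner f f \<Longrightarrow> m \<in> corner e f \<Longrightarrow> d (m \<cdot> y) = y \<cdot> d m"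
    "x \<in> corner e e \<Longrightarrow> n \<in> corner f e \<Longrightarrow> d (n \<cdot> x) = x \<cdot> d n"
    "y \<in> corner f f \<Longrightarrow> n \<in> corner f e \<Longrightarrow> d (y \<cdot> n) = d n \<cdot> y" for x y m n
    using d_bracket(1)[of x m] d_bracket(1)[of y m] d_bracket(2)[of x n] d_bracket(2)[of y n]
      off(1)[of m] off(2)[of n]
    by (simp_all add: lie_bracket_def commutant_mem peirce_simps d.neg d.zero)
  have mem: "u \<in> corner e p \<Longrightarrow> v \<in> corner q e \<Longrightarrow> d (u \<cdot> v) = 0"
    "u \<in> corner f p \<Longrightarrow> v \<in> corner q f \<Longrightarrow> d (u \<cdot> v) = 0" for u v p q
    by (rule diag, erule (1) corner_mult_mem)+
  have off_zero: "u \<in> corner p e \<Longrightarrow> m \<in> corner e f \<Longrightarrow> u \<cdot> d m = 0"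
    "m \<in> corner e f \<Longrightarrow> u \<in> corner f p \<Longrightarrow> d m \<cdot> u = 0"
    "u \<in> corner p f \<Longrightarrow> n \<in> corner f e \<Longrightarrow> u \<cdot> d n = 0"
    "n \<in> corner f e \<Longrightarrow> u \<in> corner e p \<Longrightarrow> d n \<cdot> u = 0" for u m n p
    using off by (blast intro: peirce_zero)+
  have jordan_add: "jordan_product mult (u + u') v = jordan_product mult u v + jordan_product mult u' v"
    "jordan_product mult v (u + u') = jordan_product mult v u + jordan_product mult v u'" for u u' v
    by (simp_all add: jordan_product_def mult_simps)
  note rules = jordan_product_def diag d.add d.zero peirce_zero off_zero mult mem mult_linear
  have "d (jordan_product mult u v) = jordan_product mult u (d v) + jordan_product mult (d u) v" for u v
  proof (induction u rule: peirce_induct)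
    case (add u u')
    then show ?case by (simp add: jordan_add d.add add_ac)
  next
    case (ee u)
    show ?case
    proof (induction v rule: peirce_induct)
      case (add v v') then show ?case by (simp add: jordan_add d.add add_ac)
    qed (use ee in \<open>simp_all add: rules e_f_mem\<close>)
  next
    case (ef u)
    show ?case
    proof (induction v rule: peirce_induct)
      case (add v v') then show ?case by (simp add: jordan_add d.add add_ac)
    next
      case (ef v)
      with \<open>u \<in> corner e f\<close> show ?case using skew(1)[of u v] by (simp add: rules algebra_simps)
    qed (use ef in \<open>simp_all add: rules\<close>)
  next
    case (fe u)
    show ?case
    proof (induction v rule: peirce_induct)
      case (add v v') then show ?case by (simp add: jordan_add d.add add_ac)
    next
      case (fe v)
      with \<open>u \<in> corner f e\<close> show ?case using skew(2)[of u v] by (simp add: rules algebra_simps)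
    qed (use fe in \<open>simp_all add: rules\<close>)
  next
    case (ff u)
    show ?case
    proof (induction v rule: peirce_induct)
      case (add v v') then show ?case by (simp add: jordan_add d.add add_ac)
    qed (use ff in \<open>simp_all add: rules\<close>)
  qed
  then show ?thesis using hom by (simp add: jordan_derivation_def)
qed

end

text \<open>
  Any Lie triple derivation satisfies \<open>image_e\<close> after subtraction of an inner derivation.
\<close>

locale peirce_lie_triple = peirce_algebra scale mult e f
  for scale :: "'r::comm_ring_1 \<Rightarrow> 'u::ab_group_add \<Rightarrow> 'u"
    and mult :: "'u \<Rightarrow> 'u \<Rightarrow> 'u" and e f :: 'u +
  fixes \<xi> :: "'u \<Rightarrow> 'u"
  assumes lie_triple: "lie_triple_derivation scale mult \<xi>"
    and image_e: "\<xi> e \<in> commutant e"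
begin

lemma hom: "module_hom scale scale \<xi>"
  using lie_triple by (simp add: lie_triple_derivation_def)

sublocale \<xi>: module_hom scale scale \<xi> by (rule hom)

lemma triple: "\<xi> \<langle>\<langle>x, y\<rangle>, z\<rangle> = \<langle>\<langle>\<xi> x, y\<rangle>, z\<rangle> + \<langle>\<langle>x, \<xi> y\<rangle>, z\<rangle> + \<langle>\<langle>x, y\<rangle>, \<xi> z\<rangle>"
  using lie_triple by (simp add: lie_triple_derivation_def)

text \<open>
  Apply \<open>\<xi>\<close> to \<open>m = [[m, e], e]\<close>: the last two terms of the triple identity both equal
  \<open>- [m, \<xi> e]\<close>, while the first one already accounts for the off-diagonal part of \<open>\<xi> m\<close>. Hence
  \<open>2 [m, \<xi> e] = 0\<close>.
\<close>

lemma image_e_commutes_off_diagonal: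
  shows "m \<in> corner e f \<Longrightarrow> \<langle>m, \<xi> e\<rangle> = 0" "n \<in> corner f e \<Longrightarrow> \<langle>n, \<xi> e\<rangle> = 0"
proof -
  show "\<langle>m, \<xi> e\<rangle> = 0" if m: "m \<in> corner e f"
  proof -
    have w: "\<langle>m, \<xi> e\<rangle> \<in> corner e f" by (rule bracket_commutant_mem(3)[OF image_e m])
    have "\<xi> m = \<langle>\<langle>\<xi> m, e\<rangle>, e\<rangle> - \<langle>m, \<xi> e\<rangle> - \<langle>m, \<xi> e\<rangle>"
      using triple[of m e e] m w by (simp add: bracket_idempotent bracket_linear \<xi>.neg)
    from arg_cong[OF this, of "\<lambda>u. e \<cdot> u \<cdot> f"]
    have "\<langle>m, \<xi> e\<rangle> + \<langle>m, \<xi> e\<rangle> = 0"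
      using w by (simp add: double_bracket_e mult_linear mult_assoc idempotents corner_absorb
        flip: neg_eq_iff_add_eq_0)
    then show ?thesis by (rule two_torsion_free)
  qed
  show "\<langle>n, \<xi> e\<rangle> = 0" if n: "n \<in> corner f e"
  proof -
    have w: "\<langle>n, \<xi> e\<rangle> \<in> corner f e" by (rule bracket_commutant_mem(4)[OF image_e n])
    have "\<xi> n = \<langle>\<langle>\<xi> n, e\<rangle>, e\<rangle> + \<langle>n, \<xi> e\<rangle> + \<langle>n, \<xi> e\<rangle>"
      using triple[of n e e] n w by (simp add: bracket_idempotent bracket_linear)
    from arg_cong[OF this, of "\<lambda>u. f \<cdot> u \<cdot> e"]
    have "\<langle>n, \<xi> e\<rangle> + \<langle>n, \<xi> e\<rangle> = 0"
      using w by (simp add: double_bracket_e mult_linear mult_assoc idempotents corner_absorb)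
    then show ?thesis by (rule two_torsion_free)
  qed
qed

lemma image_e_central: "\<xi> e \<in> center"
  using image_e image_e_commutes_off_diagonal
  by (intro center_criterion) (simp_all add: bracket_swap[of "\<xi> e"])

lemma image_off_diagonal:
  assumes "u \<in> corner e f \<or> u \<in> corner f e"
  shows "\<xi> u = e \<cdot> \<xi> u \<cdot> f + f \<cdot> \<xi> u \<cdot> e"
proof -
  have "\<langle>\<langle>u, e\<rangle>, e\<rangle> = u" using assms by (auto simp: bracket_idempotent bracket_linear)
  then show ?thesis
    using triple[of u e e] by (simp add: bracket_center[OF image_e_central] bracket_linear double_bracket_e)
qed

lemma diagonal:
  assumes "x \<in> commutant e"
  shows "\<xi> x \<in> commutant e"
proof (rule commutant_of_double_bracket)
  show "\<langle>\<langle>\<xi> x, e\<rangle>, e\<rangle> = 0"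
    using triple[of x e e] assms
    by (simp add: bracket_center[OF image_e_central] bracket_idempotent bracket_linear \<xi>.zero)
qed

lemma swap_lie_triple: "peirce_lie_triple scale mult f e \<xi>"
proof -
  have "\<xi> f \<in> commutant e" by (intro diagonal commutant_mem e_f_mem)
  then show ?thesis
    by (intro peirce_lie_triple.intro swap peirce_lie_triple_axioms.intro lie_triple)
      (simp add: commutant_f)
qed

text \<open>
  Apply \<open>\<xi>\<close> to \<open>[x, m] = - [[x, m], e]\<close>. Commutation with \<open>e\<close> has opposite signs on the two off-diagonal
  corners; so the component of \<open>\<xi> m\<close> in \<open>f U e\<close> enters with the sign of an anti-derivation, which is
  how the Jordan part arises.
\<close>

lemma bracket_ef:
  assumes x: "x \<in> commutant e" and m: "m \<in> corner e f"
  shows "\<xi> \<langle>x, m\<rangle> = \<langle>\<xi> x, m\<rangle> + \<langle>x, e \<cdot> \<xi> m \<cdot> f\<rangle> - \<langle>x, f \<cdot> \<xi> m \<cdot> e\<rangle>"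
proof -
  have xm: "\<langle>x, m\<rangle> \<in> corner e f" "\<langle>\<xi> x, m\<rangle> \<in> corner e f" "\<langle>x, e \<cdot> \<xi> m \<cdot> f\<rangle> \<in> corner e f"
    "\<langle>x, f \<cdot> \<xi> m \<cdot> e\<rangle> \<in> corner f e"
    by (intro bracket_commutant_mem x diagonal m component_mem)+
  have "\<xi> \<langle>x, m\<rangle> = - \<xi> \<langle>\<langle>x, m\<rangle>, e\<rangle>"
    using xm by (simp add: bracket_idempotent \<xi>.neg)
  also have "\<dots> = - (\<langle>\<langle>\<xi> x, m\<rangle>, e\<rangle> + \<langle>\<langle>x, \<xi> m\<rangle>, e\<rangle>)"
    by (simp add: triple bracket_center[OF image_e_central])
  also have "\<xi> m = e \<cdot> \<xi> m \<cdot> f + f \<cdot> \<xi> m \<cdot> e" using image_off_diagonal m by blast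
  also have "- (\<langle>\<langle>\<xi> x, m\<rangle>, e\<rangle> + \<langle>\<langle>x, \<dots>\<rangle>, e\<rangle>)
      = \<langle>\<xi> x, m\<rangle> + \<langle>x, e \<cdot> \<xi> m \<cdot> f\<rangle> - \<langle>x, f \<cdot> \<xi> m \<cdot> e\<rangle>"
    using xm by (simp add: bracket_linear bracket_idempotent)
  finally show ?thesis .
qed

text \<open>
  The triple commutator \<open>[[e, m], m'] = [m, m'] = 0\<close> yields \<open>[t, m'] = [m, t']\<close>, where \<open>t\<close> and \<open>t'\<close> are
  the components of \<open>\<xi> m\<close> and \<open>\<xi> m'\<close> in \<open>f U e\<close>. The two diagonal entries of this equation add up to
  the claim.
\<close>

lemma off_diagonal_skew:
  assumes m: "m \<in> corner e f" and m': "m' \<in> corner e f"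
    and \<tau>: "t = f \<cdot> \<xi> m \<cdot> e" "t' = f \<cdot> \<xi> m' \<cdot> e"
  shows "m \<cdot> t' + t \<cdot> m' + (m' \<cdot> t + t' \<cdot> m) = 0"
proof -
  have t: "t \<in> corner f e" "t' \<in> corner f e" by (simp_all add: \<tau> component_mem)
  have s: "e \<cdot> \<xi> m \<cdot> f \<in> corner e f" "e \<cdot> \<xi> m' \<cdot> f \<in> corner e f" by (simp_all add: component_mem)
  have \<xi>m: "\<xi> m = e \<cdot> \<xi> m \<cdot> f + t" "\<xi> m' = e \<cdot> \<xi> m' \<cdot> f + t'"
    using image_off_diagonal m m' \<tau> by auto
  have "0 = \<xi> \<langle>\<langle>e, m\<rangle>, m'\<rangle>"
    using m m' by (simp add: bracket_idempotent bracket_off_diagonal \<xi>.zero)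
  also have "\<dots> = \<langle>\<langle>e, \<xi> m\<rangle>, m'\<rangle> + \<langle>\<langle>e, m\<rangle>, \<xi> m'\<rangle>"
    by (simp add: triple bracket_center[OF image_e_central] bracket_linear)
  also have "\<dots> = - \<langle>t, m'\<rangle> + \<langle>m, t'\<rangle>"
    by (subst \<xi>m(1), subst \<xi>m(2))
      (use m m' t s in \<open>simp add: bracket_idempotent bracket_linear bracket_off_diagonal\<close>)
  finally have *: "\<langle>t, m'\<rangle> = \<langle>m, t'\<rangle>" by simp
  have "m' \<cdot> t + m \<cdot> t' = 0"
    using arg_cong[OF *, of "\<lambda>u. e \<cdot> u"] m m' t
    by (simp add: lie_bracket_def mult_linear peirce_simps flip: neg_eq_iff_add_eq_0)
  moreover have "t \<cdot> m' + t' \<cdot> m = 0"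
    using arg_cong[OF *, of "\<lambda>u. f \<cdot> u"] m m' t
    by (simp add: lie_bracket_def mult_linear peirce_simps)
  ultimately show ?thesis by (simp add: add_ac)
qed

definition singular_part :: "'u \<Rightarrow> 'u"
  where "singular_part u = f \<cdot> \<xi> (e \<cdot> u \<cdot> f) \<cdot> e + e \<cdot> \<xi> (f \<cdot> u \<cdot> e) \<cdot> f"

lemma singular_part_eq:
  "x \<in> commutant e \<Longrightarrow> singular_part x = 0"
  "m \<in> corner e f \<Longrightarrow> singular_part m = f \<cdot> \<xi> m \<cdot> e"
  "n \<in> corner f e \<Longrightarrow> singular_part n = e \<cdot> \<xi> n \<cdot> f"
  by (simp_all add: singular_part_def mult_assoc commutantD peirce_simps \<xi>.zero mult_linear)

lemma singular_part_bracket: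
  assumes x: "x \<in> commutant e" and m: "m \<in> corner e f"
  shows "singular_part \<langle>x, m\<rangle> = - \<langle>x, singular_part m\<rangle>"
proof -
  have xm: "\<langle>x, m\<rangle> \<in> corner e f" "\<langle>\<xi> x, m\<rangle> \<in> corner e f" "\<langle>x, e \<cdot> \<xi> m \<cdot> f\<rangle> \<in> corner e f"
    "\<langle>x, f \<cdot> \<xi> m \<cdot> e\<rangle> \<in> corner f e"
    by (intro bracket_commutant_mem x diagonal m component_mem)+
  then show ?thesis
    using m by (simp add: singular_part_eq bracket_ef[OF x m] mult_linear peirce_simps)
qed

lemma swap_singular_part: "peirce_lie_triple.singular_part mult f e \<xi> = singular_part"
proof -
  interpret sw: peirce_lie_triple scale mult f e \<xi> by (rule swap_lie_triple)
  show ?thesis by (auto simp: sw.singular_part_def singular_part_def add.commute)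
qed

theorem singular_part_jordan: "jordan_derivation scale mult singular_part"
proof -
  interpret sw: peirce_lie_triple scale mult f e \<xi> by (rule swap_lie_triple)
  show ?thesis
  proof (rule singular_jordan_derivationI)
    show "module_hom scale scale singular_part"
      by (rule homI) (simp_all add: singular_part_def mult_linear \<xi>.add \<xi>.scale algebra_simps)
    show "singular_part x = 0" if "x \<in> corner e e" for x
      using that by (intro singular_part_eq commutant_mem)
    show "singular_part y = 0" if "y \<in> corner f f" for y
      using that by (intro singular_part_eq commutant_mem)
    show "singular_part m \<in> corner f e" if "m \<in> corner e f" for m
      using that by (simp add: singular_part_eq component_mem)
    show "singular_part n \<in> corner e f" if "n \<in> corner f e" for n
      using that by (simp add: singular_part_eq component_mem)
    show "singular_part \<langle>x, m\<rangle> = - \<langle>x, singular_part m\<rangle>"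
      if "x \<in> commutant e" "m \<in> corner e f" for x m using that by (rule singular_part_bracket)
    show "singular_part \<langle>x, n\<rangle> = - \<langle>x, singular_part n\<rangle>"
      if "x \<in> commutant e" "n \<in> corner f e" for x n
      using sw.singular_part_bracket[of x n] that by (simp add: commutant_f swap_singular_part)
    show "m \<cdot> singular_part m' + singular_part m \<cdot> m'
        + (m' \<cdot> singular_part m + singular_part m' \<cdot> m) = 0"
      if "m \<in> corner e f" "m' \<in> corner e f" for m m'
      using that by (intro off_diagonal_skew singular_part_eq)
    show "n \<cdot> singular_part n' + singular_part n \<cdot> n'
        + (n' \<cdot> singular_part n + singular_part n' \<cdot> n) = 0"
      if "n \<in> corner f e" "n' \<in> corner f e" for n n'
      using that by (intro sw.off_diagonal_skew singular_part_eq)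
  qed
qed

end

section \<open>The central part of a Lie triple derivation\<close>

text \<open>This is the situation after the singular part has been subtracted.\<close>

locale peirce_graded_triple = peirce_lie_triple scale mult e f \<xi>
  for scale :: "'r::comm_ring_1 \<Rightarrow> 'u::ab_group_add \<Rightarrow> 'u"
    and mult :: "'u \<Rightarrow> 'u \<Rightarrow> 'u" and e f :: 'u and \<xi> :: "'u \<Rightarrow> 'u" +
  assumes image_ef: "m \<in> corner e f \<Longrightarrow> \<xi> m \<in> corner e f"
    and image_fe: "n \<in> corner f e \<Longrightarrow> \<xi> n \<in> corner f e"
begin

lemma swap_graded: "peirce_graded_triple scale mult f e \<xi>"
  by (intro peirce_graded_triple.intro swap_lie_triple peirce_graded_triple_axioms.intro
      image_ef image_fe)

lemma graded_bracket_ef: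
  assumes "x \<in> commutant e" "m \<in> corner e f"
  shows "\<xi> \<langle>x, m\<rangle> = \<langle>\<xi> x, m\<rangle> + \<langle>x, \<xi> m\<rangle>"
  using bracket_ef[OF assms] image_ef[OF assms(2)]
  by (simp add: mult_assoc mult_linear peirce_simps bracket_linear)

lemma graded_bracket_fe:
  "x \<in> commutant e \<Longrightarrow> n \<in> corner f e \<Longrightarrow> \<xi> \<langle>x, n\<rangle> = \<langle>\<xi> x, n\<rangle> + \<langle>x, \<xi> n\<rangle>"
  using peirce_graded_triple.graded_bracket_ef[OF swap_graded] by (simp add: commutant_f)

text \<open>
  Apply \<open>\<xi>\<close> to \<open>[[x, y], z] = 0\<close>, where \<open>x\<close> and \<open>y\<close> lie in different diagonal corners and \<open>z\<close> is arbitrary.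
\<close>

lemma cross_bracket_central:
  assumes "x \<in> corner e e" "y \<in> corner f f"
  shows "\<langle>\<xi> x, y\<rangle> + \<langle>x, \<xi> y\<rangle> \<in> center"
proof -
  have "\<langle>x, y\<rangle> = 0" using assms by (simp add: lie_bracket_def peirce_zero)
  then show ?thesis
    using triple[of x y] by (simp add: center_iff_bracket bracket_linear \<xi>.zero)
qed

lemma cross_bracket_mem:
  assumes "x \<in> corner e e" "y \<in> corner f f"
  shows "\<langle>\<xi> x, y\<rangle> \<in> corner f f" "\<langle>x, \<xi> y\<rangle> \<in> corner e e"
proof -
  have D: "\<xi> x \<in> commutant e" "\<xi> y \<in> commutant e" using assms by (simp_all add: diagonal commutant_mem)
  show "\<langle>\<xi> x, y\<rangle> \<in> corner f f" using D(1) assms(2) by (rule bracket_commutant_mem)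
  show "\<langle>x, \<xi> y\<rangle> \<in> corner e e"
    using bracket_commutant_mem(5)[OF D(2) assms(1)] by (subst bracket_swap) (rule corner_closed)
qed

text \<open>
  If \<open>[\<xi> x, y] = 0\<close>, then \<open>[x, \<xi> y]\<close> is itself central and lies in \<open>e U e\<close>, so it vanishes.
\<close>

lemma e_part_central_of_f_parts:
  assumes "\<And>x. x \<in> corner e e \<Longrightarrow> f \<cdot> \<xi> x \<in> corner_center f" and y: "y \<in> corner f f"
  shows "e \<cdot> \<xi> y \<in> corner_center e"
proof -
  have D: "\<xi> y \<in> commutant e" using y by (intro diagonal commutant_mem)
  have "\<langle>e \<cdot> \<xi> y, x\<rangle> = 0" if x: "x \<in> corner e e" for x
  proof -
    interpret sw: peirce_algebra scale mult f e by (rule swap)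
    have "\<langle>f \<cdot> \<xi> x, y\<rangle> = 0"
      using assms(1)[OF x] y by (simp add: corner_center_def lie_bracket_def)
    then have "\<langle>\<xi> x, y\<rangle> = 0"
      using sw.bracket_e_part[of y "\<xi> x"] x y
      by (simp add: commutant_f diagonal commutant_mem bracket_swap[of y])
    then have "\<langle>x, \<xi> y\<rangle> = 0"
      using cross_bracket_central[OF x y] cross_bracket_mem[OF x y] by (simp add: center_corner_zero)
    then show ?thesis using bracket_e_part[OF x D] by simp
  qed
  then show ?thesis
    using commutant_split(1)[OF D] by (simp add: corner_center_def lie_bracket_def)
qed

text \<open>
  The commutator \<open>[x, \<xi> y]\<close> is the \<open>e\<close>-entry of a central element, hence central in \<open>e U e\<close>.
\<close>

lemma e_part_central_of_bracket_condition:
  assumes "corner_bracket_central e" and y: "y \<in> corner f f"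
  shows "e \<cdot> \<xi> y \<in> corner_center e"
proof -
  have D: "\<xi> y \<in> commutant e" using y by (intro diagonal commutant_mem)
  have "\<langle>e \<cdot> \<xi> y, x\<rangle> \<in> corner_center e" if x: "x \<in> corner e e" for x
  proof -
    have "e \<cdot> (\<langle>\<xi> x, y\<rangle> + \<langle>x, \<xi> y\<rangle>) = \<langle>x, \<xi> y\<rangle>"
      using cross_bracket_mem[OF x y] by (simp add: mult_linear peirce_simps)
    then have "\<langle>x, \<xi> y\<rangle> \<in> corner_center e"
      using center_part_mem(1)[OF cross_bracket_central[OF x y]] by simp
    then have "0 - \<langle>x, \<xi> y\<rangle> \<in> corner_center e"
      using center_part_mem(1)[OF subspace_0[OF subspace_center]]
      by (intro corner_center_diff) (simp_all add: mult_linear)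
    then show ?thesis using bracket_e_part[OF x D] by simp
  qed
  then show ?thesis
    using assms(1) commutant_split(1)[OF D] unfolding corner_bracket_central_def by blast
qed

lemma perfect_f_part:
  assumes "corner_triple_perfect e" "x \<in> corner e e"
  shows "f \<cdot> \<xi> x = 0"
proof (rule corner_triple_perfect_vanish[OF assms(1) _ assms(2), where g = "\<lambda>u. f \<cdot> \<xi> u"])
  show "module_hom scale scale (\<lambda>u. f \<cdot> \<xi> u)"
    by (rule homI) (simp_all add: \<xi>.add \<xi>.scale mult_linear)
  show "f \<cdot> \<xi> \<langle>\<langle>x, y\<rangle>, z\<rangle> = 0"
    if x: "x \<in> corner e e" and y: "y \<in> corner e e" and z: "z \<in> corner e e" for x y z
  proof -
    have *: "\<langle>\<xi> u, v\<rangle> \<in> corner e e" "\<langle>v, \<xi> u\<rangle> \<in> corner e e"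
      if "u \<in> corner e e" "v \<in> corner e e" for u v
      using bracket_commutant_mem(5)[OF diagonal[OF commutant_mem(1)] that(2), OF that(1)]
      by (simp_all add: bracket_swap[of v "\<xi> u"] corner_closed)
    have **: "\<langle>u, v\<rangle> \<in> corner e e" if "u \<in> corner e e" "v \<in> corner e e" for u v
      using that by (intro bracket_commutant_mem commutant_mem)
    have "\<langle>\<langle>\<xi> x, y\<rangle>, z\<rangle> \<in> corner e e" "\<langle>\<langle>x, \<xi> y\<rangle>, z\<rangle> \<in> corner e e" "\<langle>\<langle>x, y\<rangle>, \<xi> z\<rangle> \<in> corner e e"
      using x y z by (auto intro: * **)
    then show ?thesis by (simp add: triple mult_linear peirce_simps)
  qed
qed

lemma image_mod_center:
  assumes "x \<in> corner e e" "z \<in> center" "f \<cdot> \<xi> x = f \<cdot> z"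
  shows "\<xi> x - z \<in> corner e e"
proof -
  have "\<xi> x - z \<in> commutant e"
    using diagonal[OF commutant_mem(1)[OF assms(1)]] center_commutant[OF assms(2), of e]
    by (simp add: commutant_def mult_linear)
  from commutant_split(1,3)[OF this] show ?thesis using assms(3) by (simp add: mult_linear)
qed

lemma image_mod_center_of_lift:
  assumes "center_lifts f" "x \<in> corner e e" "f \<cdot> \<xi> x \<in> corner_center f"
  shows "\<exists>z \<in> center. \<xi> x - z \<in> corner e e"
  using assms image_mod_center[OF assms(2)] unfolding center_lifts_def by metis

lemma image_mod_center_of_perfect:
  assumes "corner_triple_perfect e" "x \<in> corner e e"
  shows "\<exists>z \<in> center. \<xi> x - z \<in> corner e e"
  using image_mod_center[OF assms(2) subspace_0[OF subspace_center]] perfect_f_part[OF assms]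
    subspace_0[OF subspace_center] by (metis mult_linear(8))

lemma perfect_f_part_central:
  assumes "corner_triple_perfect e" "x \<in> corner e e"
  shows "f \<cdot> \<xi> x \<in> corner_center f"
  using perfect_f_part[OF assms] center_part_mem(2)[OF subspace_0[OF subspace_center]]
  by (simp add: mult_linear)

text \<open>
  In each case one first shows that the entry of \<open>\<xi> x\<close> in the opposite corner is zero, by
  perfectness, or central there; in the latter case it lifts to a central element of \<open>U\<close>. Knowing this
  for one corner gives it for the other by \<open>e_part_central_of_f_parts\<close>.
\<close>

lemma image_splits:
  assumes "center_condition e f"
  shows "(\<forall>x \<in> corner e e. \<exists>z \<in> center. \<xi> x - z \<in> corner e e) \<and>
    (\<forall>y \<in> corner f f. \<exists>z \<in> center. \<xi> y - z \<in> corner f f)"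
proof -
  interpret sw: peirce_graded_triple scale mult f e \<xi> by (rule swap_graded)
  from assms consider "corner_triple_perfect e" "corner_triple_perfect f"
    | "center_lifts e" "corner_triple_perfect e" | "center_lifts f" "corner_triple_perfect f"
    | "center_lifts e" "center_lifts f" "corner_bracket_central e"
    | "center_lifts e" "center_lifts f" "corner_bracket_central f"
    unfolding center_condition_def by blast
  then show ?thesis
  proof cases
    case 1
    then show ?thesis by (blast intro: image_mod_center_of_perfect sw.image_mod_center_of_perfect)
  next
    case 2
    then show ?thesis
      by (blast intro: image_mod_center_of_perfect sw.image_mod_center_of_lift
          e_part_central_of_f_parts perfect_f_part_central)
  next
    case 3
    then show ?thesis
      by (blast intro: sw.image_mod_center_of_perfect image_mod_center_of_lift
          sw.e_part_central_of_f_parts sw.perfect_f_part_central)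
  next
    case 4
    then show ?thesis
      by (blast intro: image_mod_center_of_lift sw.image_mod_center_of_lift
          sw.e_part_central_of_f_parts e_part_central_of_bracket_condition)
  next
    case 5
    then show ?thesis
      by (blast intro: image_mod_center_of_lift sw.image_mod_center_of_lift
          e_part_central_of_f_parts sw.e_part_central_of_bracket_condition)
  qed
qed

lemma center_Int_corner: "center \<inter> corner e e = {0}" "center \<inter> corner f f = {0}"
  using center_corner_zero center_corner_zero' subspace_0[OF subspace_center] corner_closed(4)
  by blast+

text \<open>
  The corrections of \<open>image_splits\<close> are unique, since no nonzero central element lies in a corner; so
  they depend linearly on the element, and they extend by zero to the off-diagonal corners.
\<close>

lemma central_part:
  assumes "center_condition e f"
  obtains \<psi> where "module_hom scale scale \<psi>" "\<And>u. \<psi> u \<in> center"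
    "\<And>x. x \<in> corner e e \<Longrightarrow> \<xi> x - \<psi> x \<in> corner e e"
    "\<And>y. y \<in> corner f f \<Longrightarrow> \<xi> y - \<psi> y \<in> corner f f"
    "\<And>m. m \<in> corner e f \<Longrightarrow> \<psi> m = 0" "\<And>n. n \<in> corner f e \<Longrightarrow> \<psi> n = 0"
proof -
  have hom: "module_hom scale scale (\<lambda>u. \<xi> (p \<cdot> u \<cdot> p))" for p
    by (rule homI) (simp_all add: mult_linear \<xi>.add \<xi>.scale)
  obtain \<psi>\<^sub>e where e: "module_hom scale scale \<psi>\<^sub>e" "\<And>u. \<psi>\<^sub>e u \<in> center"
    "\<And>u. \<xi> (e \<cdot> u \<cdot> e) - \<psi>\<^sub>e u \<in> corner e e" "\<And>u. \<xi> (e \<cdot> u \<cdot> e) = 0 \<Longrightarrow> \<psi>\<^sub>e u = 0"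
    using linear_choice[OF hom[of e] subspace_center subspace_corner center_Int_corner(1)]
      image_splits[OF assms] component_mem(1) by metis
  obtain \<psi>\<^sub>f where f: "module_hom scale scale \<psi>\<^sub>f" "\<And>u. \<psi>\<^sub>f u \<in> center"
    "\<And>u. \<xi> (f \<cdot> u \<cdot> f) - \<psi>\<^sub>f u \<in> corner f f" "\<And>u. \<xi> (f \<cdot> u \<cdot> f) = 0 \<Longrightarrow> \<psi>\<^sub>f u = 0"
    using linear_choice[OF hom[of f] subspace_center subspace_corner center_Int_corner(2)]
      image_splits[OF assms] component_mem(4) by metis
  show ?thesis
  proof (rule that[of "\<lambda>u. \<psi>\<^sub>e u + \<psi>\<^sub>f u"])
    show "module_hom scale scale (\<lambda>u. \<psi>\<^sub>e u + \<psi>\<^sub>f u)"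
      using e(1) f(1) by (auto simp: module_hom_iff algebra_simps)
    show "\<psi>\<^sub>e u + \<psi>\<^sub>f u \<in> center" for u
      using e(2) f(2) by (intro subspace_add[OF subspace_center])
    show "\<xi> x - (\<psi>\<^sub>e x + \<psi>\<^sub>f x) \<in> corner e e" if "x \<in> corner e e" for x
      using that e(3)[of x] f(4)[of x] by (simp add: mult_assoc peirce_simps mult_linear \<xi>.zero)
    show "\<xi> y - (\<psi>\<^sub>e y + \<psi>\<^sub>f y) \<in> corner f f" if "y \<in> corner f f" for y
      using that f(3)[of y] e(4)[of y] by (simp add: mult_assoc peirce_simps mult_linear \<xi>.zero)
    show "\<psi>\<^sub>e m + \<psi>\<^sub>f m = 0" if "m \<in> corner e f" for m
      using that e(4)[of m] f(4)[of m] by (simp add: mult_assoc peirce_simps mult_linear \<xi>.zero)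
    show "\<psi>\<^sub>e n + \<psi>\<^sub>f n = 0" if "n \<in> corner f e" for n
      using that e(4)[of n] f(4)[of n] by (simp add: mult_assoc peirce_simps mult_linear \<xi>.zero)
  qed
qed

end

section \<open>Maps preserving the Peirce decomposition\<close>

text \<open>
  The brackets below lie in off-diagonal corners, where the central correction vanishes; so subtracting
  that correction preserves the Lie triple identity for them. The disjunctions make the hypotheses invariant under
  exchanging \<open>e\<close> and \<open>f\<close>.
\<close>

locale peirce_graded_map = peirce_algebra scale mult e f
  for scale :: "'r::comm_ring_1 \<Rightarrow> 'u::ab_group_add \<Rightarrow> 'u"
    and mult :: "'u \<Rightarrow> 'u \<Rightarrow> 'u" and e f :: 'u +
  fixes \<delta> :: "'u \<Rightarrow> 'u"
  assumes hom: "module_hom scale scale \<delta>"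
    and image: "x \<in> corner e e \<Longrightarrow> \<delta> x \<in> corner e e" "m \<in> corner e f \<Longrightarrow> \<delta> m \<in> corner e f"
      "n \<in> corner f e \<Longrightarrow> \<delta> n \<in> corner f e" "y \<in> corner f f \<Longrightarrow> \<delta> y \<in> corner f f"
    and bracket: "x \<in> commutant e \<Longrightarrow> u \<in> corner e f \<or> u \<in> corner f e \<Longrightarrow>
      \<delta> (lie_bracket mult x u) = lie_bracket mult (\<delta> x) u + lie_bracket mult x (\<delta> u)"
    and off_triple: "m \<in> corner e f \<and> n \<in> corner f e \<and> m' \<in> corner e f \<or>
        m \<in> corner f e \<and> n \<in> corner e f \<and> m' \<in> corner f e \<Longrightarrow>
      \<delta> (lie_bracket mult (lie_bracket mult m n) m') =
        lie_bracket mult (lie_bracket mult (\<delta> m) n) m' +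
        lie_bracket mult (lie_bracket mult m (\<delta> n)) m' +
        lie_bracket mult (lie_bracket mult m n) (\<delta> m')"
begin

sublocale \<delta>: module_hom scale scale \<delta> by (rule hom)

lemma swap_graded_map: "peirce_graded_map scale mult f e \<delta>"
  by (intro peirce_graded_map.intro swap peirce_graded_map_axioms.intro hom image bracket
      off_triple) (auto simp: commutant_f)

definition defect :: "'u \<Rightarrow> 'u \<Rightarrow> 'u"
  where "defect u v = \<delta> (u \<cdot> v) - \<delta> u \<cdot> v - u \<cdot> \<delta> v"

lemma defect_linear: "defect (u + u') v = defect u v + defect u' v"
    "defect u (v + v') = defect u v + defect u v'"
  by (simp_all add: defect_def \<delta>.add mult_simps)

text \<open>
  The defect is the Hochschild coboundary of \<open>\<delta>\<close>, hence a cocycle. Most facts below come from this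
  identity, with all but one or two of its terms vanishing.
\<close>

lemma defect_cocycle: "u \<cdot> defect v w - defect (u \<cdot> v) w + defect u (v \<cdot> w) - defect u v \<cdot> w = 0"
  by (simp add: defect_def mult_simps)

lemma defect_mixed:
  "x \<in> corner e e \<Longrightarrow> m \<in> corner e f \<Longrightarrow> defect x m = 0"
  "m \<in> corner e f \<Longrightarrow> y \<in> corner f f \<Longrightarrow> defect m y = 0"
  "n \<in> corner f e \<Longrightarrow> x \<in> corner e e \<Longrightarrow> defect n x = 0"
  "y \<in> corner f f \<Longrightarrow> n \<in> corner f e \<Longrightarrow> defect y n = 0"
  using bracket[of x m] bracket[of y m] bracket[of x n] bracket[of y n]
    image(1)[of x] image(2)[of m] image(3)[of n] image(4)[of y]
  by (simp_all add: defect_def lie_bracket_def commutant_mem peirce_zero \<delta>.neg algebra_simps)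

text \<open>
  The cocycle identities for \<open>(x, x', m)\<close> and \<open>(n, x, x')\<close> say that \<open>defect x x'\<close> annihilates \<open>m\<close> from
  the left and \<open>n\<close> from the right.
\<close>

lemma defect_ee:
  assumes x: "x \<in> corner e e" and x': "x' \<in> corner e e"
  shows "defect x x' = 0"
proof (rule faithful_e)
  show "defect x x' \<in> corner e e"
    unfolding defect_def by (intro corner_closed image corner_mult_mem[of _ e e _ e e] x x')
  show "defect x x' \<cdot> m = 0" if m: "m \<in> corner e f" for m
    using defect_cocycle[of x x' m] defect_mixed(1)[OF x' m] defect_mixed(1)[OF x]
      defect_mixed(1)[OF corner_mult_mem[OF x x'] m] corner_mult_mem[OF x' m]
    by (simp add: mult_linear)
  show "n \<cdot> defect x x' = 0" if n: "n \<in> corner f e" for n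
    using defect_cocycle[of n x x'] defect_mixed(3)[OF n x] defect_mixed(3)[OF _ x']
      defect_mixed(3)[OF n corner_mult_mem[OF x x']] corner_mult_mem[OF n x]
    by (simp add: mult_linear)
qed

lemma defect_ff: "y \<in> corner f f \<Longrightarrow> y' \<in> corner f f \<Longrightarrow> defect y y' = 0"
  by (rule peirce_graded_map.defect_ee[OF swap_graded_map])

lemma defect_off_mem:
  assumes "m \<in> corner e f" "n \<in> corner f e"
  shows "defect m n \<in> corner e e" "defect n m \<in> corner f f"
proof -
  show "defect m n \<in> corner e e"
    unfolding defect_def by (intro corner_closed image corner_mult_mem[of _ e f _ f e] assms)
  show "defect n m \<in> corner f f"
    unfolding defect_def by (intro corner_closed image corner_mult_mem[of _ f e _ e f] assms)
qed

text \<open>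
  Here \<open>[[m, n], m'] = (m n) m' + m' (n m)\<close>. Evaluate \<open>\<delta>\<close> on it both by the Lie triple identity and by
  the product rules for a diagonal and an off-diagonal factor; the two results differ by the claim.
\<close>

lemma defect_anticommutes:
  assumes m: "m \<in> corner e f" and n: "n \<in> corner f e" and m': "m' \<in> corner e f"
  shows "defect m n \<cdot> m' + m' \<cdot> defect n m = 0"
proof -
  have "\<delta> (m \<cdot> n \<cdot> m') = \<delta> (m \<cdot> n) \<cdot> m' + m \<cdot> n \<cdot> \<delta> m'"
    using defect_mixed(1)[OF corner_mult_mem[OF m n] m'] by (simp add: defect_def algebra_simps)
  moreover have "\<delta> (m' \<cdot> (n \<cdot> m)) = \<delta> m' \<cdot> (n \<cdot> m) + m' \<cdot> \<delta> (n \<cdot> m)"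
    using defect_mixed(2)[OF m' corner_mult_mem[OF n m]] by (simp add: defect_def algebra_simps)
  moreover have "\<delta> \<langle>\<langle>m, n\<rangle>, m'\<rangle> = \<delta> (m \<cdot> n \<cdot> m') + \<delta> (m' \<cdot> (n \<cdot> m))"
    using m m' by (simp add: lie_bracket_def mult_linear mult_assoc peirce_zero \<delta>.add)
  moreover have "\<delta> \<langle>\<langle>m, n\<rangle>, m'\<rangle> = \<langle>\<langle>\<delta> m, n\<rangle>, m'\<rangle> + \<langle>\<langle>m, \<delta> n\<rangle>, m'\<rangle> + \<langle>\<langle>m, n\<rangle>, \<delta> m'\<rangle>"
    using m n m' by (intro off_triple) simp
  moreover have "\<langle>\<langle>\<delta> m, n\<rangle>, m'\<rangle> = \<delta> m \<cdot> n \<cdot> m' + m' \<cdot> (n \<cdot> \<delta> m)"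
    "\<langle>\<langle>m, \<delta> n\<rangle>, m'\<rangle> = m \<cdot> \<delta> n \<cdot> m' + m' \<cdot> (\<delta> n \<cdot> m)"
    "\<langle>\<langle>m, n\<rangle>, \<delta> m'\<rangle> = m \<cdot> n \<cdot> \<delta> m' + \<delta> m' \<cdot> (n \<cdot> m)"
    using m m' n image(2)[OF m] image(2)[OF m'] image(3)[OF n]
    by (simp_all add: lie_bracket_def mult_linear mult_assoc peirce_zero)
  ultimately show ?thesis
    by (simp add: defect_def mult_linear mult_assoc algebra_simps)
qed

lemma defect_central:
  assumes m: "m \<in> corner e f" and n: "n \<in> corner f e"
  shows "defect m n - defect n m \<in> center"
proof (rule center_criterion)
  interpret sw: peirce_graded_map scale mult f e \<delta> by (rule swap_graded_map)
  note mem = defect_off_mem[OF m n]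
  show "defect m n - defect n m \<in> commutant e"
    using commutant_mem(1)[OF mem(1)] commutant_mem(2)[OF mem(2)]
    by (simp add: commutant_def mult_linear)
  show "\<langle>defect m n - defect n m, m'\<rangle> = 0" if m': "m' \<in> corner e f" for m'
    using defect_anticommutes[OF m n m'] mem m'
    by (simp add: lie_bracket_def mult_linear peirce_zero)
  show "\<langle>defect m n - defect n m, n'\<rangle> = 0" if n': "n' \<in> corner f e" for n'
    using sw.defect_anticommutes[OF n m n'] mem n'
    by (simp add: lie_bracket_def mult_linear peirce_zero flip: neg_eq_iff_add_eq_0)
qed

lemma defect_corner_center:
  assumes "m \<in> corner e f" "n \<in> corner f e"
  shows "defect m n \<in> corner_center e"
  using center_part_mem(1)[OF defect_central[OF assms]] defect_off_mem[OF assms]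
  by (simp add: mult_linear peirce_simps)

text \<open>
  The cocycle identity for \<open>(m, n, m')\<close> turns left into right multiplication, and
  \<open>defect_anticommutes\<close> turns it back with the opposite sign.
\<close>

lemma defect_skew:
  assumes m: "m \<in> corner e f" and n: "n \<in> corner f e" and m': "m' \<in> corner e f"
  shows "defect m n \<cdot> m' + defect m' n \<cdot> m = 0"
proof -
  have "defect m n \<cdot> m' = m \<cdot> defect n m'"
    using defect_cocycle[of m n m'] defect_mixed(1)[OF corner_mult_mem[OF m n] m']
      defect_mixed(2)[OF m corner_mult_mem[OF n m']] by simp
  then show ?thesis using defect_anticommutes[OF m' n m] by (simp add: add.commute)
qed

text \<open>
  Hence the multiples of \<open>defect m n\<close> are again values of the defect, and therefore central.
\<close>

lemma defect_left_linear:
  assumes x: "x \<in> corner e e" and m: "m \<in> corner e f" and n: "n \<in> corner f e"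
  shows "x \<cdot> defect m n = defect (x \<cdot> m) n"
  using defect_cocycle[of x m n] defect_mixed(1)[OF x m] defect_ee[OF x corner_mult_mem[OF m n]]
  by (simp add: mult_linear)

lemma defect_zero_of_no_central_ideal:
  assumes "no_central_ideal e" and m: "m \<in> corner e f" and n: "n \<in> corner f e"
  shows "defect m n = 0"
proof -
  have "x \<cdot> defect m n \<in> corner_center e" if "x \<in> corner e e" for x
    using defect_left_linear[OF that m n] defect_corner_center[OF corner_mult_mem[OF that m] n] by simp
  then show ?thesis
    using assms(1) defect_off_mem(1)[OF m n] unfolding no_central_ideal_def by blast
qed

text \<open>
  An element \<open>defect m n\<close> that annihilates the witness \<open>w\<close> would, paired with \<open>0\<close> in the other corner,
  be central in \<open>U\<close>, so it is \<open>0\<close>. By skewness this applies first to \<open>m = w\<close>, using \<open>2\<close>-torsion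
  freeness, and then to every \<open>m\<close>.
\<close>

lemma defect_zero_of_witness:
  assumes "witness_detects_center e f" and m: "m \<in> corner e f" and n: "n \<in> corner f e"
  shows "defect m n = 0"
proof -
  obtain w where w: "w \<in> corner e f" and detect: "\<And>a b. a \<in> corner_center e \<Longrightarrow>
      b \<in> corner_center f \<Longrightarrow> a \<cdot> w = w \<cdot> b \<Longrightarrow> a + b \<in> center"
    using assms(1) unfolding witness_detects_center_def by blast
  have zero: "defect m n = 0" if m: "m \<in> corner e f" and "defect m n \<cdot> w = 0" for m
  proof -
    have "0 \<in> corner_center f"
      using center_part_mem(2)[OF subspace_0[OF subspace_center]] by (simp add: mult_linear)
    then have "defect m n + 0 \<in> center"
      using defect_corner_center[OF m n] that by (intro detect) (simp_all add: mult_linear)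
    then show ?thesis using defect_off_mem(1)[OF m n] by (simp add: center_corner_zero)
  qed
  have "defect w n = 0"
    by (rule zero[OF w two_torsion_free[OF defect_skew[OF w n w]]])
  then have "defect m n \<cdot> w = 0"
    using defect_skew[OF m n w] by (simp add: mult_linear)
  with m show ?thesis by (rule zero)
qed

text \<open>
  The difference of the two sides is central, and a central element with one zero entry is zero.
\<close>

lemma defect_reflect:
  assumes "m \<in> corner e f" "n \<in> corner f e"
  shows "defect m n = 0 \<longleftrightarrow> defect n m = 0"
proof
  assume "defect m n = 0"
  then have "- (defect m n - defect n m) = defect n m" by simp
  then have "defect n m \<in> center"
    using subspace_neg[OF subspace_center defect_central[OF assms]] by simp
  then show "defect n m = 0" using defect_off_mem(2)[OF assms] by (rule center_corner_zero')
next
  assume "defect n m = 0"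
  then have "defect m n \<in> center" using defect_central[OF assms] by simp
  then show "defect m n = 0" using defect_off_mem(1)[OF assms] by (rule center_corner_zero)
qed

lemma defect_off_zero:
  assumes "central_ideal_condition e f" and m: "m \<in> corner e f" and n: "n \<in> corner f e"
  shows "defect m n = 0" "defect n m = 0"
proof -
  interpret sw: peirce_graded_map scale mult f e \<delta> by (rule swap_graded_map)
  show "defect m n = 0"
    using assms defect_zero_of_no_central_ideal defect_zero_of_witness defect_reflect
      sw.defect_zero_of_no_central_ideal sw.defect_zero_of_witness
    unfolding central_ideal_condition_def by blast
  then show "defect n m = 0" using defect_reflect[OF m n] by simp
qed

theorem derivation_of_central_ideal_condition:
  assumes "central_ideal_condition e f"
  shows "derivation scale mult \<delta>"
proof -
  note mixed = defect_ee defect_ff defect_mixed defect_off_zero[OF assms]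
  have kill: "defect u v = 0"
    if "u \<in> corner p q" "v \<in> corner r s" "\<delta> u \<in> corner p q" "\<delta> v \<in> corner r s" "q \<cdot> r = 0"
    for u v p q r s
    using that by (simp add: defect_def corner_zero[of _ p q _ r s] \<delta>.zero)
  have disjoint: "u \<in> corner e e \<Longrightarrow> v \<in> corner f e \<Longrightarrow> defect u v = 0"
    "u \<in> corner e e \<Longrightarrow> v \<in> corner f f \<Longrightarrow> defect u v = 0"
    "u \<in> corner e f \<Longrightarrow> v \<in> corner e f \<Longrightarrow> defect u v = 0"
    "u \<in> corner e f \<Longrightarrow> v \<in> corner e e \<Longrightarrow> defect u v = 0"
    "u \<in> corner f e \<Longrightarrow> v \<in> corner f e \<Longrightarrow> defect u v = 0"
    "u \<in> corner f e \<Longrightarrow> v \<in> corner f f \<Longrightarrow> defect u v = 0"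
    "u \<in> corner f f \<Longrightarrow> v \<in> corner e f \<Longrightarrow> defect u v = 0"
    "u \<in> corner f f \<Longrightarrow> v \<in> corner e e \<Longrightarrow> defect u v = 0" for u v
    by (rule kill, assumption, assumption, erule image, erule image, simp add: ef fe)+
  have "defect u v = 0" for u v
  proof (induction u rule: peirce_induct)
    case (ee u) then show ?case
      by (induction v rule: peirce_induct) (simp_all add: defect_linear mixed disjoint)
  next
    case (ef u) then show ?case
      by (induction v rule: peirce_induct) (simp_all add: defect_linear mixed disjoint)
  next
    case (fe u) then show ?case
      by (induction v rule: peirce_induct) (simp_all add: defect_linear mixed disjoint)
  next
    case (ff u) then show ?case
      by (induction v rule: peirce_induct) (simp_all add: defect_linear mixed disjoint)
  qed (simp add: defect_linear)
  then have "\<delta> (u \<cdot> v) = \<delta> u \<cdot> v + u \<cdot> \<delta> v" for u v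
    using defect_def[of u v] by (simp add: algebra_simps)
  with hom show ?thesis by (simp add: derivation_def)
qed

end

theorem (in peirce_graded_triple) derivation_plus_central:
  assumes "center_condition e f" "central_ideal_condition e f"
  shows "\<exists>\<delta> \<psi>. derivation scale mult \<delta> \<and> module_hom scale scale \<psi> \<and> range \<psi> \<subseteq> center \<and>
    (\<forall>u. \<xi> u = \<delta> u + \<psi> u)"
proof -
  obtain \<psi> where \<psi>: "module_hom scale scale \<psi>" "\<And>u. \<psi> u \<in> center"
    "\<And>x. x \<in> corner e e \<Longrightarrow> \<xi> x - \<psi> x \<in> corner e e"
    "\<And>y. y \<in> corner f f \<Longrightarrow> \<xi> y - \<psi> y \<in> corner f f"
    "\<And>m. m \<in> corner e f \<Longrightarrow> \<psi> m = 0" "\<And>n. n \<in> corner f e \<Longrightarrow> \<psi> n = 0"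
    using central_part[OF assms(1)] by metis
  interpret \<psi>: module_hom scale scale \<psi> by (rule \<psi>(1))
  define \<delta> where "\<delta> u = \<xi> u - \<psi> u" for u
  interpret \<delta>: peirce_graded_map scale mult e f \<delta>
  proof
    show "\<delta> (x + y) = \<delta> x + \<delta> y" "\<delta> (scale r x) = scale r (\<delta> x)" for x y r
      by (simp_all add: \<delta>_def \<xi>.add \<psi>.add \<xi>.scale \<psi>.scale algebra_simps)
    show "\<delta> x \<in> corner e e" if "x \<in> corner e e" for x using that \<psi>(3) by (simp add: \<delta>_def)
    show "\<delta> m \<in> corner e f" if "m \<in> corner e f" for m using that \<psi>(5) image_ef by (simp add: \<delta>_def)
    show "\<delta> n \<in> corner f e" if "n \<in> corner f e" for n using that \<psi>(6) image_fe by (simp add: \<delta>_def)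
    show "\<delta> y \<in> corner f f" if "y \<in> corner f f" for y using that \<psi>(4) by (simp add: \<delta>_def)
    show "\<delta> \<langle>x, u\<rangle> = \<langle>\<delta> x, u\<rangle> + \<langle>x, \<delta> u\<rangle>"
      if x: "x \<in> commutant e" and u: "u \<in> corner e f \<or> u \<in> corner f e" for x u
    proof -
      have "\<psi> \<langle>x, u\<rangle> = 0" using u x \<psi>(5,6) bracket_commutant_mem(1,2)[OF x] by blast
      moreover have "\<xi> \<langle>x, u\<rangle> = \<langle>\<xi> x, u\<rangle> + \<langle>x, \<xi> u\<rangle>"
        using u x graded_bracket_ef graded_bracket_fe by blast
      ultimately show ?thesis by (simp add: \<delta>_def bracket_linear bracket_center[OF \<psi>(2)])
    qed
    show "\<delta> \<langle>\<langle>m, n\<rangle>, m'\<rangle> = \<langle>\<langle>\<delta> m, n\<rangle>, m'\<rangle> + \<langle>\<langle>m, \<delta> n\<rangle>, m'\<rangle> + \<langle>\<langle>m, n\<rangle>, \<delta> m'\<rangle>"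
      if "m \<in> corner e f \<and> n \<in> corner f e \<and> m' \<in> corner e f \<or>
        m \<in> corner f e \<and> n \<in> corner e f \<and> m' \<in> corner f e" for m n m'
    proof -
      have "\<langle>m, n\<rangle> \<in> commutant e"
        using that by (auto simp: commutant_def lie_bracket_def mult_linear mult_assoc peirce_simps)
      then have "\<psi> \<langle>\<langle>m, n\<rangle>, m'\<rangle> = 0" using that \<psi>(5,6) bracket_commutant_mem(1,2) by blast
      then show ?thesis by (simp add: \<delta>_def triple bracket_linear bracket_center[OF \<psi>(2)])
    qed
  qed
  have "derivation scale mult \<delta>" by (rule \<delta>.derivation_of_central_ideal_condition[OF assms(2)])
  then show ?thesis
    using \<psi> by (intro exI[of _ \<delta>] exI[of _ \<psi>]) (auto simp: \<delta>_def)
qed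

theorem (in peirce_algebra) lie_triple_derivation_decomposition:
  assumes \<xi>: "lie_triple_derivation scale mult \<xi>"
    and conditions: "center_condition e f" "central_ideal_condition e f"
  shows "\<exists>\<delta> d \<psi>. derivation scale mult \<delta> \<and> jordan_derivation scale mult d \<and>
    (\<forall>m \<in> corner e f. d m \<in> corner f e) \<and> (\<forall>n \<in> corner f e. d n \<in> corner e f) \<and>
    module_hom scale scale \<psi> \<and> range \<psi> \<subseteq> center \<and> (\<forall>u. \<xi> u = \<delta> u + d u + \<psi> u)"
proof -
  define t where "t = \<langle>\<xi> e, e\<rangle>"
  define \<xi>\<^sub>1 where "\<xi>\<^sub>1 u = \<xi> u - \<langle>t, u\<rangle>" for u
  interpret \<xi>\<^sub>1: peirce_lie_triple scale mult e f \<xi>\<^sub>1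
  proof
    show "lie_triple_derivation scale mult \<xi>\<^sub>1"
      unfolding \<xi>\<^sub>1_def by (intro lie_triple_derivation_diff \<xi> lie_triple_derivation_inner)
    \<comment> \<open>The map \<open>u \<mapsto> [[u, e], e]\<close> is a projection, and \<open>[t, e]\<close> is its value at \<open>\<xi> e\<close>.\<close>
    have "\<langle>\<langle>\<xi>\<^sub>1 e, e\<rangle>, e\<rangle> = 0"
      by (simp add: \<xi>\<^sub>1_def t_def double_bracket_e bracket_linear)
        (simp add: mult_linear mult_assoc idempotents)
    then show "\<xi>\<^sub>1 e \<in> commutant e" by (rule commutant_of_double_bracket)
  qed
  let ?d = "\<xi>\<^sub>1.singular_part"
  have d: "jordan_derivation scale mult ?d" by (rule \<xi>\<^sub>1.singular_part_jordan)
  define \<xi>\<^sub>2 where "\<xi>\<^sub>2 u = \<xi>\<^sub>1 u - ?d u" for u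
  have off: "\<xi>\<^sub>2 m = e \<cdot> \<xi>\<^sub>1 m \<cdot> f" if "m \<in> corner e f" for m
    using that \<xi>\<^sub>1.image_off_diagonal[of m] by (simp add: \<xi>\<^sub>2_def \<xi>\<^sub>1.singular_part_eq diff_eq_eq)
  have off': "\<xi>\<^sub>2 n = f \<cdot> \<xi>\<^sub>1 n \<cdot> e" if "n \<in> corner f e" for n
    using that \<xi>\<^sub>1.image_off_diagonal[of n]
    by (simp add: \<xi>\<^sub>2_def \<xi>\<^sub>1.singular_part_eq diff_eq_eq add.commute)
  interpret \<xi>\<^sub>2: peirce_graded_triple scale mult e f \<xi>\<^sub>2
  proof
    show "lie_triple_derivation scale mult \<xi>\<^sub>2"
      unfolding \<xi>\<^sub>2_def
      by (intro lie_triple_derivation_diff \<xi>\<^sub>1.lie_triple lie_triple_derivation_of_jordan d)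
    show "\<xi>\<^sub>2 e \<in> commutant e"
      using \<xi>\<^sub>1.image_e by (simp add: \<xi>\<^sub>2_def \<xi>\<^sub>1.singular_part_eq(1) commutant_mem(1) e_f_mem)
    show "\<xi>\<^sub>2 m \<in> corner e f" if "m \<in> corner e f" for m
      using off[OF that] by (simp add: component_mem)
    show "\<xi>\<^sub>2 n \<in> corner f e" if "n \<in> corner f e" for n
      using off'[OF that] by (simp add: component_mem)
  qed
  obtain \<delta> \<psi> where \<delta>: "derivation scale mult \<delta>"
    and \<psi>: "module_hom scale scale \<psi>" "range \<psi> \<subseteq> center" and sum: "\<And>u. \<xi>\<^sub>2 u = \<delta> u + \<psi> u"
    using \<xi>\<^sub>2.derivation_plus_central[OF conditions] by blast
  have "derivation scale mult (\<lambda>u. \<langle>t, u\<rangle> + \<delta> u)"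
    by (intro derivation_sum derivation_inner \<delta>)
  moreover have "\<xi> u = (\<langle>t, u\<rangle> + \<delta> u) + ?d u + \<psi> u" for u
    using sum[of u] by (simp add: \<xi>\<^sub>2_def \<xi>\<^sub>1_def algebra_simps)
  moreover have "\<forall>m \<in> corner e f. ?d m \<in> corner f e" "\<forall>n \<in> corner f e. ?d n \<in> corner e f"
    by (simp_all add: \<xi>\<^sub>1.singular_part_eq component_mem)
  ultimately show ?thesis
    using d \<psi> by blast
qed

text \<open>
  The Lie triple derivation \<open>\<xi>\<close> supplies \<open>\<delta>\<close>, \<open>d\<close> and a central summand \<open>\<psi>\<close>; the triple centralizer
  \<open>\<Lambda> - \<xi>\<close> supplies \<open>l\<close> and a second central summand \<open>\<chi>\<close>.
\<close>

theorem (in peirce_algebra) generalized_lie_triple_derivation_decomposition: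
  assumes \<Lambda>: "generalized_lie_triple_derivation scale mult \<xi> \<Lambda>"
    and conditions: "center_condition e f" "central_ideal_condition e f"
  shows "\<exists>\<delta> d \<psi> l. derivation scale mult \<delta> \<and> jordan_derivation scale mult d \<and>
    (\<forall>m \<in> corner e f. d m \<in> corner f e) \<and> (\<forall>n \<in> corner f e. d n \<in> corner e f) \<and>
    l \<in> center \<and> module_hom scale scale \<psi> \<and> range \<psi> \<subseteq> center \<and>
    (\<forall>x \<in> triple_commutator_space scale mult. \<psi> x = 0) \<and>
    (\<forall>u. \<Lambda> u = \<delta> u + d u + \<psi> u + l \<cdot> u)"
proof -
  have \<xi>: "lie_triple_derivation scale mult \<xi>" and \<Lambda>_hom: "module_hom scale scale \<Lambda>"
    and triple: "\<And>x y z. \<Lambda> \<langle>\<langle>x, y\<rangle>, z\<rangle> = \<langle>\<langle>\<Lambda> x, y\<rangle>, z\<rangle> + \<langle>\<langle>x, \<xi> y\<rangle>, z\<rangle> + \<langle>\<langle>x, y\<rangle>, \<xi> z\<rangle>"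
    using \<Lambda> by (simp_all add: generalized_lie_triple_derivation_def)
  have \<xi>_hom: "module_hom scale scale \<xi>" using \<xi> by (simp add: lie_triple_derivation_def)
  obtain \<delta> d \<psi> where \<delta>: "derivation scale mult \<delta>" and d: "jordan_derivation scale mult d"
    and d_off: "\<forall>m \<in> corner e f. d m \<in> corner f e" "\<forall>n \<in> corner f e. d n \<in> corner e f"
    and \<psi>: "module_hom scale scale \<psi>" "range \<psi> \<subseteq> center" and sum: "\<And>u. \<xi> u = \<delta> u + d u + \<psi> u"
    using lie_triple_derivation_decomposition[OF \<xi> conditions] by blast
  have \<psi>_eq: "\<psi> = (\<lambda>u. \<xi> u - \<delta> u - d u)" by (simp add: sum fun_eq_iff)
  have "lie_triple_derivation scale mult \<psi>"
    unfolding \<psi>_eq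
    by (intro lie_triple_derivation_diff \<xi> lie_triple_derivation_of_derivation \<delta>
        lie_triple_derivation_of_jordan d)
  then have \<psi>_zero: "\<psi> x = 0" if "x \<in> triple_commutator_space scale mult" for x
    using \<psi>(2) that by (rule central_lie_triple_derivation_vanishes)
  define \<Delta> where "\<Delta> u = \<Lambda> u - \<xi> u" for u
  interpret \<Delta>: peirce_triple_centralizer scale mult e f \<Delta>
  proof
    show "\<Delta> (x + y) = \<Delta> x + \<Delta> y" "\<Delta> (scale r x) = scale r (\<Delta> x)" for x y r
      using \<Lambda>_hom \<xi>_hom by (simp_all add: \<Delta>_def module_hom_iff algebra_simps)
    show "\<Delta> \<langle>\<langle>x, y\<rangle>, z\<rangle> = \<langle>\<langle>\<Delta> x, y\<rangle>, z\<rangle>" for x y z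
      using \<xi> by (simp add: \<Delta>_def triple lie_triple_derivation_def bracket_linear)
  qed
  obtain l where l: "l \<in> center" and central: "\<And>u. \<Delta> u - l \<cdot> u \<in> center"
    using \<Delta>.triple_centralizer_standard_form[OF conditions(1)] by blast
  define \<chi> where "\<chi> u = \<Delta> u - l \<cdot> u" for u
  have \<chi>_hom: "module_hom scale scale \<chi>"
    by (rule homI) (simp_all add: \<chi>_def \<Delta>.\<Delta>.add \<Delta>.\<Delta>.scale mult_linear algebra_simps)
  have \<chi>_zero: "\<chi> x = 0" if "x \<in> triple_commutator_space scale mult" for x
  proof (rule hom_zero_on_span[where g = \<chi> and S = "{\<langle>\<langle>x, y\<rangle>, z\<rangle> | x y z. True}"])
    have pull: "l \<cdot> \<langle>x, y\<rangle> = \<langle>l \<cdot> x, y\<rangle>" for x y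
      using centerD[OF l, of y] by (simp add: lie_bracket_def mult_linear) (simp flip: mult_assoc)
    have "\<chi> \<langle>\<langle>x, y\<rangle>, z\<rangle> = \<langle>\<langle>\<chi> x, y\<rangle>, z\<rangle>" for x y z
      by (simp add: \<chi>_def \<Delta>.triple1 bracket_linear pull)
    moreover have "\<chi> x \<in> center" for x using central by (simp add: \<chi>_def)
    ultimately show "\<chi> y = 0" if "y \<in> {\<langle>\<langle>x, y\<rangle>, z\<rangle> | x y z. True}" for y
      using that by (auto simp: bracket_center bracket_linear)
  qed (use that \<chi>_hom in \<open>simp_all add: triple_commutator_space_def\<close>)
  have "module_hom scale scale (\<lambda>u. \<psi> u + \<chi> u)"
    using \<psi>(1) \<chi>_hom by (auto simp: module_hom_iff algebra_simps)
  moreover have "range (\<lambda>u. \<psi> u + \<chi> u) \<subseteq> center"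
    using \<psi>(2) central subspace_add[OF subspace_center] by (auto simp: \<chi>_def)
  moreover have "\<Lambda> u = \<delta> u + d u + (\<psi> u + \<chi> u) + l \<cdot> u" for u
    using sum[of u] by (simp add: \<chi>_def \<Delta>_def algebra_simps)
  ultimately show ?thesis
    using \<delta> d d_off l \<psi>_zero \<chi>_zero
    by (intro exI[of _ \<delta>] exI[of _ d] exI[of _ "\<lambda>u. \<psi> u + \<chi> u"] exI[of _ l]) simp
qed

section \<open>Generalized matrix algebras\<close>

text \<open>
  Unital matrix algebras are those with units \<open>oneA\<close>, \<open>oneB\<close> acting as identities; naming
  the units makes the diagonal idempotents available as terms.
\<close>

locale faithful_morita_context = morita_context K
  for K :: "('r::comm_ring_1, 'a::ring, 'b::ring, 'm::ab_group_add, 'n::ab_group_add) morita_data" +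
  fixes oneA :: 'a and oneB :: 'b
  assumes unit_A: "oneA * a = a" "a * oneA = a" and unit_B: "oneB * b = b" "b * oneB = b"
    and unit_M: "actAM K oneA m = m" "actMB K m oneB = m"
    and unit_N: "actBN K oneB n = n" "actNA K n oneA = n"
    and torsion_free: "X + X = 0 \<Longrightarrow> X = (0 :: ('a, 'm, 'n, 'b) gmat)"
    and faithful_A: "(\<And>m. actAM K a m = 0) \<Longrightarrow> (\<And>n. actNA K n a = 0) \<Longrightarrow> a = 0"
    and faithful_B: "(\<And>m. actMB K m b = 0) \<Longrightarrow> (\<And>n. actBN K b n = 0) \<Longrightarrow> b = 0"
begin

abbreviation E :: "('a, 'm, 'n, 'b) gmat" where "E \<equiv> Mat oneA 0 0 0"
abbreviation F :: "('a, 'm, 'n, 'b) gmat" where "F \<equiv> Mat 0 0 0 oneB"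

lemma action_zero:
  "actAM K 0 m = 0" "actAM K a 0 = 0" "actMB K 0 b = 0" "actMB K m 0 = 0"
  "actBN K 0 n = 0" "actBN K b 0 = 0" "actNA K 0 a = 0" "actNA K n 0 = 0"
  "pairMN K 0 n = 0" "pairMN K m 0 = 0" "pairNM K 0 m = 0" "pairNM K n 0 = 0"
proof -
  have zero: "g 0 y = 0" "g x 0 = 0" if "module_bilinear s1 s2 s3 g" for s1 s2 s3 g x y
    using that module_hom.zero unfolding module_bilinear_def by fastforce+
  show "actAM K 0 m = 0" "actAM K a 0 = 0" "actMB K 0 b = 0" "actMB K m 0 = 0"
    "actBN K 0 n = 0" "actBN K b 0 = 0" "actNA K 0 a = 0" "actNA K n 0 = 0"
    "pairMN K 0 n = 0" "pairMN K m 0 = 0" "pairNM K 0 m = 0" "pairNM K n 0 = 0"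
    by (rule zero[OF MN.left.lact_bilinear] zero[OF MN.left.ract_bilinear]
        zero[OF MN.right.lact_bilinear] zero[OF MN.right.ract_bilinear]
        zero[OF MN.pair_bilinear] zero[OF NM.pair_bilinear])+
qed

lemmas matrix_simps = action_zero unit_A unit_B unit_M unit_N
  zero_gmat_def plus_gmat_def minus_gmat_def uminus_gmat_def

sublocale U: assoc_algebra "gm_scale K" "gm_mult K" by (rule gm_assoc_algebra)

lemma corner_iff:
  "X \<in> U.corner E E \<longleftrightarrow> (\<exists>a. X = Mat a 0 0 0)" "X \<in> U.corner E F \<longleftrightarrow> (\<exists>m. X = Mat 0 m 0 0)"
  "X \<in> U.corner F E \<longleftrightarrow> (\<exists>n. X = Mat 0 0 n 0)" "X \<in> U.corner F F \<longleftrightarrow> (\<exists>b. X = Mat 0 0 0 b)"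
  by (cases X; auto simp: U.corner_def matrix_simps)+

lemma corner_ball:
  "(\<forall>X \<in> U.corner E E. P X) \<longleftrightarrow> (\<forall>a. P (Mat a 0 0 0))"
  "(\<forall>X \<in> U.corner F F. P X) \<longleftrightarrow> (\<forall>b. P (Mat 0 0 0 b))"
  unfolding Ball_def corner_iff by blast+

sublocale U: peirce_algebra "gm_scale K" "gm_mult K" E F
proof
  show "gm_mult K (E + F) X = X" "gm_mult K X (E + F) = X" for X
    by (cases X; simp add: matrix_simps)+
  show "X = 0" if X: "X \<in> U.corner E E" and "\<And>m. m \<in> U.corner E F \<Longrightarrow> gm_mult K X m = 0"
    "\<And>n. n \<in> U.corner F E \<Longrightarrow> gm_mult K n X = 0" for X
  proof -
    obtain a where a: "X = Mat a 0 0 0" using X corner_iff by blast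
    have "actAM K a m = 0" for m using that(2)[of "Mat 0 m 0 0"] by (simp add: a corner_iff matrix_simps)
    moreover have "actNA K n a = 0" for n
      using that(3)[of "Mat 0 0 n 0"] by (simp add: a corner_iff matrix_simps)
    ultimately show ?thesis using faithful_A by (simp add: a zero_gmat_def)
  qed
  show "X = 0" if X: "X \<in> U.corner F F" and "\<And>m. m \<in> U.corner E F \<Longrightarrow> gm_mult K m X = 0"
    "\<And>n. n \<in> U.corner F E \<Longrightarrow> gm_mult K X n = 0" for X
  proof -
    obtain b where b: "X = Mat 0 0 0 b" using X corner_iff by blast
    have "actMB K m b = 0" for m using that(2)[of "Mat 0 m 0 0"] by (simp add: b corner_iff matrix_simps)
    moreover have "actBN K b n = 0" for n
      using that(3)[of "Mat 0 0 n 0"] by (simp add: b corner_iff matrix_simps)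
    ultimately show ?thesis using faithful_B by (simp add: b zero_gmat_def)
  qed
  show "X = 0" if "X + X = 0" for X :: "('a, 'm, 'n, 'b) gmat"
    using that by (rule torsion_free)
qed (simp_all add: matrix_simps)

lemma corner_center_iff:
  "Mat a 0 0 0 \<in> U.corner_center E \<longleftrightarrow> a \<in> algebra_center (*)"
  "Mat 0 0 0 b \<in> U.corner_center F \<longleftrightarrow> b \<in> algebra_center (*)"
  by (simp_all add: U.corner_center_def corner_ball algebra_center_def matrix_simps corner_iff)

lemma corner_centerE:
  "X \<in> U.corner_center E \<Longrightarrow> \<exists>a. X = Mat a 0 0 0 \<and> a \<in> algebra_center (*)"
  "X \<in> U.corner_center F \<Longrightarrow> \<exists>b. X = Mat 0 0 0 b \<and> b \<in> algebra_center (*)"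
  using corner_center_iff by (auto simp: U.corner_center_def corner_iff)

lemma corner_bracket:
  "lie_bracket (gm_mult K) (Mat a 0 0 0) (Mat a' 0 0 0) = Mat (lie_bracket (*) a a') 0 0 0"
  "lie_bracket (gm_mult K) (Mat 0 0 0 b) (Mat 0 0 0 b') = Mat 0 0 0 (lie_bracket (*) b b')"
  by (simp_all add: lie_bracket_def matrix_simps)

lemma center_diagonal:
  assumes "Z \<in> algebra_center (gm_mult K)"
  shows "gm_mult K E Z = Mat (matA Z) 0 0 0" "gm_mult K F Z = Mat 0 0 0 (matB Z)"
  using U.commutant_split(1,2)[OF U.center_commutant[OF assms]]
  by (cases Z; auto simp: corner_iff matrix_simps)+

lemma center_lifts_of_projection:
  "matA ` algebra_center (gm_mult K) = algebra_center (*) \<Longrightarrow> U.center_lifts E"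
  "matB ` algebra_center (gm_mult K) = algebra_center (*) \<Longrightarrow> U.center_lifts F"
  unfolding U.center_lifts_def using center_diagonal corner_centerE by (metis imageE)+

text \<open>
  The embedding of a diagonal entry into \<open>U\<close> is linear and preserves commutators, so it carries the span of
  triple commutators in the ring to the span of those in the corner.
\<close>

lemma corner_triple_perfect_of_full:
  "triple_commutator_space (scaleA K) (*) = UNIV \<Longrightarrow> U.corner_triple_perfect E"
  "triple_commutator_space (scaleB K) (*) = UNIV \<Longrightarrow> U.corner_triple_perfect F"
proof -
  show "U.corner_triple_perfect E" if full: "triple_commutator_space (scaleA K) (*) = UNIV"
  proof -
    let ?T = "{lie_bracket (gm_mult K) (lie_bracket (gm_mult K) x y) z | x y z.
      x \<in> U.corner E E \<and> y \<in> U.corner E E \<and> z \<in> U.corner E E}"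
    have "Mat a 0 0 0 \<in> U.span ?T" for a
    proof -
      have "a \<in> MN.left.left.span {lie_bracket (*) (lie_bracket (*) x y) z | x y z. True}"
        using full by (simp add: triple_commutator_space_def)
      then show ?thesis
      proof (induction rule: MN.left.left.span_induct_alt)
        case base
        then show ?case using U.span_zero[of ?T] by (simp add: zero_gmat_def)
      next
        case (step c x y)
        then obtain u v w where "x = lie_bracket (*) (lie_bracket (*) u v) w" by blast
        then have "Mat x 0 0 0 \<in> ?T"
          by (simp add: corner_iff) (metis corner_bracket(1))
        then have "gm_scale K c (Mat x 0 0 0) + Mat y 0 0 0 \<in> U.span ?T"
          by (intro U.span_add U.span_scale U.span_base step)
        then show ?case by (simp add: plus_gmat_def)
      qed
    qed
    then show ?thesis by (simp only: U.corner_triple_perfect_def subset_eq corner_ball simp_thms)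
  qed
  show "U.corner_triple_perfect F" if full: "triple_commutator_space (scaleB K) (*) = UNIV"
  proof -
    let ?T = "{lie_bracket (gm_mult K) (lie_bracket (gm_mult K) x y) z | x y z.
      x \<in> U.corner F F \<and> y \<in> U.corner F F \<and> z \<in> U.corner F F}"
    have "Mat 0 0 0 b \<in> U.span ?T" for b
    proof -
      have "b \<in> MN.left.right.span {lie_bracket (*) (lie_bracket (*) x y) z | x y z. True}"
        using full by (simp add: triple_commutator_space_def)
      then show ?thesis
      proof (induction rule: MN.left.right.span_induct_alt)
        case base
        then show ?case using U.span_zero[of ?T] by (simp add: zero_gmat_def)
      next
        case (step c x y)
        then obtain u v w where "x = lie_bracket (*) (lie_bracket (*) u v) w" by blast
        then have "Mat 0 0 0 x \<in> ?T"
          by (simp add: corner_iff) (metis corner_bracket(2))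
        then have "gm_scale K c (Mat 0 0 0 x) + Mat 0 0 0 y \<in> U.span ?T"
          by (intro U.span_add U.span_scale U.span_base step)
        then show ?case by (simp add: plus_gmat_def)
      qed
    qed
    then show ?thesis by (simp only: U.corner_triple_perfect_def subset_eq corner_ball simp_thms)
  qed
qed

lemma corner_bracket_central_of_ring:
  "(\<forall>x::'a. range (lie_bracket (*) x) \<subseteq> algebra_center (*) \<longrightarrow> x \<in> algebra_center (*)) \<Longrightarrow>
    U.corner_bracket_central E"
  "(\<forall>x::'b. range (lie_bracket (*) x) \<subseteq> algebra_center (*) \<longrightarrow> x \<in> algebra_center (*)) \<Longrightarrow>
    U.corner_bracket_central F"
  unfolding U.corner_bracket_central_def
  by (simp_all add: corner_ball corner_bracket corner_center_iff image_subset_iff)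

text \<open>
  If all multiples of \<open>c\<close> are central, they form a central ideal, which contains \<open>c\<close> by unitality.
\<close>

lemma no_central_ideal_of_ring:
  "(\<forall>I. central_ideal (scaleA K) (*) I \<longrightarrow> I = {0}) \<Longrightarrow> U.no_central_ideal E"
  "(\<forall>I. central_ideal (scaleB K) (*) I \<longrightarrow> I = {0}) \<Longrightarrow> U.no_central_ideal F"
proof -
  have principal: "central_ideal s (*) (range (\<lambda>x. x * c))"
    if "assoc_algebra s (*)" "\<And>x. x * c \<in> algebra_center (*)"
    for s :: "'r \<Rightarrow> 'c::ring \<Rightarrow> 'c" and c
  proof -
    interpret assoc_algebra s "(*)" by (rule that(1))
    have "subspace (range (\<lambda>x. x * c))"
    proof (rule subspaceI)
      show "0 \<in> range (\<lambda>x. x * c)" by (rule range_eqI[of _ _ 0]) simp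
      show "x + y \<in> range (\<lambda>x. x * c)" if "x \<in> range (\<lambda>x. x * c)" "y \<in> range (\<lambda>x. x * c)" for x y
        using that by (auto simp flip: distrib_right)
      show "s r x \<in> range (\<lambda>x. x * c)" if "x \<in> range (\<lambda>x. x * c)" for r x
        using that by (auto simp flip: mult_linear(9))
    qed
    moreover have "y * (x * c) \<in> range (\<lambda>x. x * c)" for x y by (simp flip: mult.assoc)
    moreover have "x * c * y = y * (x * c)" for x y using that(2)[of x] by (simp add: algebra_center_def)
    ultimately show ?thesis using that(2) by (auto simp: central_ideal_def algebra_ideal_def)
  qed
  show "U.no_central_ideal E" if none: "\<forall>I. central_ideal (scaleA K) (*) I \<longrightarrow> I = {0}"
    unfolding U.no_central_ideal_def
  proof (intro ballI impI)
    fix C assume "C \<in> U.corner E E" and C: "\<forall>X \<in> U.corner E E. gm_mult K X C \<in> U.corner_center E"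
    then obtain c where c: "C = Mat c 0 0 0" using corner_iff by blast
    have "x * c \<in> algebra_center (*)" for x
      using C[rule_format, of "Mat x 0 0 0"] by (simp add: c corner_iff corner_center_iff matrix_simps)
    then have "range (\<lambda>x. x * c) = {0}"
      using none principal[OF MN.left.left.assoc_algebra_axioms] by blast
    then have "oneA * c = 0" by blast
    then show "C = 0" by (simp add: c matrix_simps)
  qed
  show "U.no_central_ideal F" if none: "\<forall>I. central_ideal (scaleB K) (*) I \<longrightarrow> I = {0}"
    unfolding U.no_central_ideal_def
  proof (intro ballI impI)
    fix C assume "C \<in> U.corner F F" and C: "\<forall>X \<in> U.corner F F. gm_mult K X C \<in> U.corner_center F"
    then obtain c where c: "C = Mat 0 0 0 c" using corner_iff by blast
    have "x * c \<in> algebra_center (*)" for x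
      using C[rule_format, of "Mat 0 0 0 x"] by (simp add: c corner_iff corner_center_iff matrix_simps)
    then have "range (\<lambda>x. x * c) = {0}"
      using none principal[OF MN.left.right.assoc_algebra_axioms] by blast
    then have "oneB * c = 0" by blast
    then show "C = 0" by (simp add: c matrix_simps)
  qed
qed

lemma witness_of_center_formula:
  "algebra_center (gm_mult K) = {Mat a 0 0 b | a b. a \<in> algebra_center (*) \<and>
      b \<in> algebra_center (*) \<and> actAM K a m\<^sub>0 = actMB K m\<^sub>0 b} \<Longrightarrow> U.witness_detects_center E F"
  "algebra_center (gm_mult K) = {Mat a 0 0 b | a b. a \<in> algebra_center (*) \<and>
      b \<in> algebra_center (*) \<and> actNA K n\<^sub>0 a = actBN K b n\<^sub>0} \<Longrightarrow> U.witness_detects_center F E"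
proof -
  show "U.witness_detects_center E F" if "algebra_center (gm_mult K) = {Mat a 0 0 b | a b.
      a \<in> algebra_center (*) \<and> b \<in> algebra_center (*) \<and> actAM K a m\<^sub>0 = actMB K m\<^sub>0 b}"
    unfolding U.witness_detects_center_def that
    by (intro bexI[of _ "Mat 0 m\<^sub>0 0 0"])
      (auto dest!: corner_centerE simp: corner_iff matrix_simps)
  show "U.witness_detects_center F E" if "algebra_center (gm_mult K) = {Mat a 0 0 b | a b.
      a \<in> algebra_center (*) \<and> b \<in> algebra_center (*) \<and> actNA K n\<^sub>0 a = actBN K b n\<^sub>0}"
    unfolding U.witness_detects_center_def that
    by (intro bexI[of _ "Mat 0 0 n\<^sub>0 0"])
      (auto dest!: corner_centerE simp: corner_iff matrix_simps)
qed

lemma singular_jordan_derivation_of_corners: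
  assumes d: "jordan_derivation (gm_scale K) (gm_mult K) d"
    and off: "\<forall>m \<in> U.corner E F. d m \<in> U.corner F E" "\<forall>n \<in> U.corner F E. d n \<in> U.corner E F"
  shows "singular_jordan_derivation K d"
proof -
  interpret d: module_hom "gm_scale K" "gm_scale K" d using d by (simp add: jordan_derivation_def)
  define \<tau> where "\<tau> m = matN (d (Mat 0 m 0 0))" for m
  define \<rho> where "\<rho> n = matM (d (Mat 0 0 n 0))" for n
  have \<tau>: "d (Mat 0 m 0 0) = Mat 0 0 (\<tau> m) 0" for m
    using off(1)[rule_format, of "Mat 0 m 0 0"] by (auto simp: \<tau>_def corner_iff)
  have \<rho>: "d (Mat 0 0 n 0) = Mat 0 (\<rho> n) 0 0" for n
    using off(2)[rule_format, of "Mat 0 0 n 0"] by (auto simp: \<rho>_def corner_iff)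
  have "module_hom (scaleM K) (scaleN K) \<tau>"
  proof (intro module_hom.intro module_hom_axioms.intro MN.left.module_axioms MN.right.module_axioms)
    show "\<tau> (m + m') = \<tau> m + \<tau> m'" for m m'
      using d.add[of "Mat 0 m 0 0" "Mat 0 m' 0 0"] by (simp add: \<tau> plus_gmat_def)
    show "\<tau> (scaleM K r m) = scaleN K r (\<tau> m)" for r m
      using d.scale[of r "Mat 0 m 0 0"] by (simp add: \<tau>)
  qed
  moreover have "module_hom (scaleN K) (scaleM K) \<rho>"
  proof (intro module_hom.intro module_hom_axioms.intro MN.left.module_axioms MN.right.module_axioms)
    show "\<rho> (n + n') = \<rho> n + \<rho> n'" for n n'
      using d.add[of "Mat 0 0 n 0" "Mat 0 0 n' 0"] by (simp add: \<rho> plus_gmat_def)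
    show "\<rho> (scaleN K r n) = scaleM K r (\<rho> n)" for r n
      using d.scale[of r "Mat 0 0 n 0"] by (simp add: \<rho>)
  qed
  moreover have "d (Mat 0 m n 0) = Mat 0 (\<rho> n) (\<tau> m) 0" for m n
    using d.add[of "Mat 0 m 0 0" "Mat 0 0 n 0"] by (simp add: \<tau> \<rho> plus_gmat_def)
  ultimately show ?thesis using d by (auto simp: singular_jordan_derivation_def)
qed

end

theorem theorem4p2:
  fixes K :: "('r::comm_ring_1, 'a::ring, 'b::ring, 'm::ab_group_add, 'n::ab_group_add) morita_data"
    and \<Lambda> \<xi> :: "('a, 'm, 'n, 'b) gmat \<Rightarrow> ('a, 'm, 'n, 'b) gmat"
  assumes "morita_context K"
    and unital: "is_unital (gm_mult K)"
    and two_torsion_free: "\<forall>X :: ('a, 'm, 'n, 'b) gmat. X + X = 0 \<longrightarrow> X = 0"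
    and faithful_A: "\<forall>a. (\<forall>m. actAM K a m = 0) \<and> (\<forall>n. actNA K n a = 0) \<longrightarrow> a = 0"
    and faithful_B: "\<forall>b. (\<forall>m. actMB K m b = 0) \<and> (\<forall>n. actBN K b n = 0) \<longrightarrow> b = 0"
    and cond_i_iv:
      "(triple_commutator_space (scaleA K) (*) = UNIV \<and>
        triple_commutator_space (scaleB K) (*) = UNIV) \<or>
       (matA ` algebra_center (gm_mult K) = algebra_center (*) \<and>
        triple_commutator_space (scaleA K) (*) = UNIV) \<or>
       (matB ` algebra_center (gm_mult K) = algebra_center (*) \<and>
        triple_commutator_space (scaleB K) (*) = UNIV) \<or>
       (matA ` algebra_center (gm_mult K) = algebra_center (*) \<and>
        matB ` algebra_center (gm_mult K) = algebra_center (*) \<and>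
        ((\<forall>x::'a. range (lie_bracket (*) x) \<subseteq> algebra_center (*) \<longrightarrow> x \<in> algebra_center (*)) \<or>
         (\<forall>x::'b. range (lie_bracket (*) x) \<subseteq> algebra_center (*) \<longrightarrow> x \<in> algebra_center (*))))"
    and cond_a_d:
      "(\<forall>I. central_ideal (scaleA K) (*) I \<longrightarrow> I = {0}) \<or>
       (\<forall>I. central_ideal (scaleB K) (*) I \<longrightarrow> I = {0}) \<or>
       (\<exists>m\<^sub>0. algebra_center (gm_mult K) =
          {Mat a 0 0 b | a b. a \<in> algebra_center (*) \<and> b \<in> algebra_center (*) \<and>
             actAM K a m\<^sub>0 = actMB K m\<^sub>0 b}) \<or>
       (\<exists>n\<^sub>0. algebra_center (gm_mult K) =
          {Mat a 0 0 b | a b. a \<in> algebra_center (*) \<and> b \<in> algebra_center (*) \<and>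
             actNA K n\<^sub>0 a = actBN K b n\<^sub>0})"
    and "generalized_lie_triple_derivation (gm_scale K) (gm_mult K) \<xi> \<Lambda>"
  shows "\<exists>\<delta> d \<psi> lam.
     derivation (gm_scale K) (gm_mult K) \<delta> \<and>
     singular_jordan_derivation K d \<and>
     lam \<in> algebra_center (gm_mult K) \<and>
     module_hom (gm_scale K) (gm_scale K) \<psi> \<and>
     range \<psi> \<subseteq> algebra_center (gm_mult K) \<and>
     (\<forall>X \<in> triple_commutator_space (gm_scale K) (gm_mult K). \<psi> X = 0) \<and>
     (\<forall>X. \<Lambda> X = \<delta> X + d X + \<psi> X + gm_mult K lam X)"
proof -
  interpret morita_context K by fact
  obtain oneA oneB where units: "\<And>a. oneA * a = a" "\<And>a. a * oneA = a"
    "\<And>b. oneB * b = b" "\<And>b. b * oneB = b" "\<And>m. actAM K oneA m = m" "\<And>m. actMB K m oneB = m"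
    "\<And>n. actBN K oneB n = n" "\<And>n. actNA K n oneA = n"
    using unital unfolding gm_unital_iff by blast
  interpret faithful_morita_context K oneA oneB
    using units two_torsion_free faithful_A faithful_B by unfold_locales blast+
  have "U.center_condition E F"
    using cond_i_iv corner_triple_perfect_of_full center_lifts_of_projection
      corner_bracket_central_of_ring unfolding U.center_condition_def by blast
  moreover have "U.central_ideal_condition E F"
    unfolding U.central_ideal_condition_def
    by (insert cond_a_d, elim disjE exE;
        drule no_central_ideal_of_ring witness_of_center_formula; simp)
  ultimately obtain \<delta> d \<psi> lam where
    "derivation (gm_scale K) (gm_mult K) \<delta>" "jordan_derivation (gm_scale K) (gm_mult K) d"
    "\<forall>m \<in> U.corner E F. d m \<in> U.corner F E" "\<forall>n \<in> U.corner F E. d n \<in> U.corner E F"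
    "lam \<in> algebra_center (gm_mult K)" "module_hom (gm_scale K) (gm_scale K) \<psi>"
    "range \<psi> \<subseteq> algebra_center (gm_mult K)"
    "\<forall>X \<in> triple_commutator_space (gm_scale K) (gm_mult K). \<psi> X = 0"
    "\<forall>X. \<Lambda> X = \<delta> X + d X + \<psi> X + gm_mult K lam X"
    using U.generalized_lie_triple_derivation_decomposition assms(8) by metis
  then show ?thesis using singular_jordan_derivation_of_corners by blast
qed

end
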